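(* Let $G$ be a graph with edge ideal $I=I(G)$ and let $t$ be a positive integer. (1) If $t\ge 1$ and $G$ is a triangle, then $\mathrm{Scarf}(I^t)$ is a set of $\binom{t+2}{2}$ isolated vertices. (2) If $t\ge 2$ and $G$ is a path of length $3$ with $I=(ab,bc,cd)$, then $\mathrm{Scarf}(I^t)$ is the upper triangular portion of a $t\times t$ grid of squares. That is, it is the $1$-dimensional simplicial complex (graph) whose vertices are the monomials $a^ib^{t-k}c^{t-i}d^k$ with $i,k\ge 0$ and $i+k\le t$, in which the vertices indexed by $(i,k)$ and $(i',k')$ are joined by an edge if and only if $|i-i'|+|k-k'|=1$. (3) If $t\ge 2$ and $G$ is a claw with $I=(ab,ac,ad)$, then $\mathrm{Scarf}(I^t)$ is a cycle of length $3t$ together with $\binom{t+2}{2}-3t$ isolated vertices. The cycle runs through the vertices $a^tb^ic^jd^k$ with $i+j+k=t$ and at least one of $i,j,k$ equal to $0$, in the cyclic order $$a^tb^t,\ a^tb^{t-1}c,\ \dots,\ a^tc^t,\ a^tc^{t-1}d,\ \dots,\ a^td^t,\ a^tbd^{t-1},\ \dots,\ a^tb^{t-1}d.$$ (4) If $t\ge 1$ and $G$ is a square with $I=(ab,bc,cd,da)$, then $\mathrm{Scarf}(I^t)$ is a $t\times t$ grid of squares. That is, it is the $1$-dimensional simplicial complex (graph) whose vertices are the monomials $a^ib^jc^{t-i}d^{t-j}$ with $0\le i,j\le t$, in which the vertices indexed by $(i,j)$ and $(i',j')$ are joined by an edge if and only if $|i-i'|+|j-j'|=1$. In particular, $I^t$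 does not have a Scarf resolution if $G$ is a triangle or a square and $t\ge 1$, or if $G$ is a path of length $3$ or a claw and $t\ge 2$.
   Context: Let $\mathsf k$ be an arbitrary field. For a finite simple graph $G$ with vertices identified with the variables of a polynomial ring $S$ over $\mathsf k$, the edge ideal is $I(G)=(xy \mid \{x,y\}\in E(G))\subseteq S$. A path of length $3$ has $3$ edges and $4$ vertices; a claw is a graph with three edges meeting at a common vertex (and $4$ vertices); a triangle and a square are the cycles on $3$ and $4$ vertices. For a monomial ideal $J$ with minimal monomial generating set $\mathrm{Gens}(J)$, the Taylor complex $\mathrm{Taylor}(J)$ is the full simplex with vertex set $\mathrm{Gens}(J)$: its faces are all subsets $\sigma\subseteq \mathrm{Gens}(J)$, and each face is labeled by $\mathbf m_\sigma=\mathrm{lcm}(u : u\in\sigma)$ (with $\mathbf m_\varnothing=1$). The Scarf complex $\mathrm{Scarf}(J)$ is the subcomplex of $\mathrm{Taylor}(J)$ consisting of all faces whose label is not the label of any other face of $\mathrm{Taylor}(J)$. $J$ has a Scarf resolution if $\mathrm{Scarf}(J)$ supports a free resolution of $J$, meaning that the homogenized simplicial chain complex of $\Delta=\mathrm{Scarf}(J)$ is a free resolution of $J$. This is the complex $F_i=\bigoplus_{\sigma\in\Delta,\ \dim\sigma=i} S e_\sigma$ with differential $d(e_\sigma)=\sum_{u\in\sigma}\pm\frac{\mathbf m_\sigma}{\mathbf m_{\sigma\setminus\{u\}}}e_{\sigma\setminus\{u\}}$ (usual simplicial signs), augmented by $F_0\to J$, $e_{\{u\}}\mapsto u$. *)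

theory Defs
  imports Complex_Main "HOL-Library.Poly_Mapping"
begin

text \<open>Monomials are represented by their exponent vectors, so \<open>+\<close> and \<open>-\<close> on
  \<open>'v mono\<close> are multiplication and (exact) division of monomials. The type \<open>'v\<close> of
  variables is at the same time the vertex set of the graph.\<close>

type_synonym 'v mono = "'v \<Rightarrow>\<^sub>0 nat"
type_synonym ('v, 'k) mpoly = "'v mono \<Rightarrow>\<^sub>0 'k"

definition mon :: "'v mono \<Rightarrow> ('v, 'k::field) mpoly" where
  "mon m = Poly_Mapping.single m 1"

definition var :: "'v \<Rightarrow> ('v, 'k::field) mpoly" where
  "var x = mon (Poly_Mapping.single x 1)"

lemma module_times: "module ((*) :: 'a::comm_ring_1 \<Rightarrow> 'a \<Rightarrow> 'a)"
  by unfold_locales (auto simp: algebra_simps)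

definition ideal :: "'a::comm_ring_1 set \<Rightarrow> 'a set" where
  "ideal B = module.span (*) B"

definition ideal_power :: "'a::comm_ring_1 set \<Rightarrow> nat \<Rightarrow> 'a set" where
  "ideal_power J t = ideal {\<Prod>i<t. f i | f. \<forall>i<t. f i \<in> J}"

definition simple_graph :: "'v::finite set set \<Rightarrow> bool" where
  "simple_graph E \<longleftrightarrow> (\<forall>e\<in>E. card e = 2)"

definition edge_ideal :: "'v::finite set set \<Rightarrow> ('v, 'k::field) mpoly set" where
  "edge_ideal E = ideal {var x * var y | x y. {x, y} \<in> E}"

definition triangle :: "'v::finite set set \<Rightarrow> 'v \<Rightarrow> 'v \<Rightarrow> 'v \<Rightarrow> bool" where
  "triangle E a b c \<longleftrightarrow>
     distinct [a, b, c] \<and> UNIV = {a, b, c} \<and> E = {{a, b}, {b, c}, {c, a}}"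

definition path3 :: "'v::finite set set \<Rightarrow> 'v \<Rightarrow> 'v \<Rightarrow> 'v \<Rightarrow> 'v \<Rightarrow> bool" where
  "path3 E a b c d \<longleftrightarrow>
     distinct [a, b, c, d] \<and> UNIV = {a, b, c, d} \<and> E = {{a, b}, {b, c}, {c, d}}"

definition claw :: "'v::finite set set \<Rightarrow> 'v \<Rightarrow> 'v \<Rightarrow> 'v \<Rightarrow> 'v \<Rightarrow> bool" where
  "claw E a b c d \<longleftrightarrow>
     distinct [a, b, c, d] \<and> UNIV = {a, b, c, d} \<and> E = {{a, b}, {a, c}, {a, d}}"

definition square :: "'v::finite set set \<Rightarrow> 'v \<Rightarrow> 'v \<Rightarrow> 'v \<Rightarrow> 'v \<Rightarrow> bool" where
  "square E a b c d \<longleftrightarrow>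
     distinct [a, b, c, d] \<and> UNIV = {a, b, c, d} \<and> E = {{a, b}, {b, c}, {c, d}, {d, a}}"

definition minimal_monomial_gens :: "('v, 'k::field) mpoly set \<Rightarrow> 'v mono set \<Rightarrow> bool" where
  "minimal_monomial_gens J M \<longleftrightarrow>
     ideal (mon ` M) = J \<and> (\<forall>M'. M' \<subset> M \<longrightarrow> ideal (mon ` M') \<noteq> J)"

text \<open>Meaningful for monomial ideals, which have exactly one minimal monomial generating set.\<close>

definition Gens :: "('v, 'k::field) mpoly set \<Rightarrow> 'v mono set" where
  "Gens J = (THE M. minimal_monomial_gens J M)"

text \<open>The lcm of a finite set of monomials: on \<open>nat\<close>, the supremum of a finite set is its
  maximum, and the supremum of the empty set is 0.\<close>

definition label :: "'v::finite mono set \<Rightarrow> 'v mono" where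
  "label \<sigma> = Abs_poly_mapping (\<lambda>x. SUP u\<in>\<sigma>. Poly_Mapping.lookup u x)"

definition Taylor :: "('v::finite, 'k::field) mpoly set \<Rightarrow> 'v mono set set" where
  "Taylor J = Pow (Gens J)"

definition Scarf :: "('v::finite, 'k::field) mpoly set \<Rightarrow> 'v mono set set" where
  "Scarf J = {\<sigma> \<in> Taylor J. \<forall>\<tau>\<in>Taylor J. label \<tau> = label \<sigma> \<longrightarrow> \<tau> = \<sigma>}"

text \<open>The simplicial complex of dimension at most 1 with given vertices and edges (simplicial
  complexes contain the empty face).\<close>

definition graph_complex :: "'a set \<Rightarrow> 'a set set \<Rightarrow> 'a set set" where
  "graph_complex V F = {{}} \<union> {{v} | v. v \<in> V} \<union> F"

definition grid_edges :: "(nat \<times> nat) set \<Rightarrow> (nat \<Rightarrow> nat \<Rightarrow> 'a) \<Rightarrow> 'a set set" where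
  "grid_edges D m = {{m i k, m i' k'} | i k i' k'.
     (i, k) \<in> D \<and> (i', k') \<in> D \<and> \<bar>int i - int i'\<bar> + \<bar>int k - int k'\<bar> = 1}"

definition cycle_edges :: "'a list \<Rightarrow> 'a set set" where
  "cycle_edges L = {{L ! i, L ! (Suc i mod length L)} | i. i < length L}"

definition mono4 :: "'v \<Rightarrow> 'v \<Rightarrow> 'v \<Rightarrow> 'v \<Rightarrow> nat \<Rightarrow> nat \<Rightarrow> nat \<Rightarrow> nat \<Rightarrow> 'v mono" where
  "mono4 a b c d i j k l = Poly_Mapping.single a i + Poly_Mapping.single b j
     + Poly_Mapping.single c k + Poly_Mapping.single d l"

text \<open>The homogenized chain complex. Chains are finitely supported families of polynomials indexed
  by sets of monomials, i.e. elements of the free module on the symbols \<open>e\<^sub>\<sigma>\<close>. The relation \<open>r\<close> is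
  the total order of the vertices that determines the simplicial signs.\<close>

type_synonym ('v, 'k) chain = "'v mono set \<Rightarrow>\<^sub>0 ('v, 'k) mpoly"

definition chains :: "'v::finite mono set set \<Rightarrow> nat \<Rightarrow> ('v, 'k::field) chain set" where
  "chains \<Delta> i = {f. \<forall>\<sigma>\<in>Poly_Mapping.keys f. \<sigma> \<in> \<Delta> \<and> card \<sigma> = Suc i}"

definition face_sign :: "'a rel \<Rightarrow> 'a \<Rightarrow> 'a set \<Rightarrow> 'b::comm_ring_1" where
  "face_sign r u \<sigma> = (-1) ^ card {w \<in> \<sigma>. w \<noteq> u \<and> (w, u) \<in> r}"

definition boundary :: "'v::finite mono rel \<Rightarrow> ('v, 'k::field) chain \<Rightarrow> ('v, 'k) chain" where
  "boundary r f = (\<Sum>\<sigma>\<in>Poly_Mapping.keys f. \<Sum>u\<in>\<sigma>. Poly_Mapping.single (\<sigma> - {u})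
     (face_sign r u \<sigma> * mon (label \<sigma> - label (\<sigma> - {u})) * Poly_Mapping.lookup f \<sigma>))"

definition augmentation :: "('v::finite, 'k::field) chain \<Rightarrow> ('v, 'k) mpoly" where
  "augmentation f = (\<Sum>\<sigma>\<in>Poly_Mapping.keys f. \<Sum>u\<in>\<sigma>. mon u * Poly_Mapping.lookup f \<sigma>)"

text \<open>Exactness of \<open>\<dots> \<rightarrow> F\<^sub>2 \<rightarrow> F\<^sub>1 \<rightarrow> F\<^sub>0 \<rightarrow> J \<rightarrow> 0\<close>.\<close>

definition supports_resolution ::
    "'v::finite mono rel \<Rightarrow> 'v mono set set \<Rightarrow> ('v, 'k::field) mpoly set \<Rightarrow> bool" where
  "supports_resolution r \<Delta> J \<longleftrightarrow>
     augmentation ` chains \<Delta> 0 = J \<and>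
     {f \<in> chains \<Delta> 0. augmentation f = 0} = (boundary r ` chains \<Delta> 1 :: ('v, 'k) chain set) \<and>
     (\<forall>i\<ge>1. {f \<in> chains \<Delta> i. boundary r f = 0} =
        (boundary r ` chains \<Delta> (Suc i) :: ('v, 'k) chain set))"

text \<open>Up to isomorphism the complex does not depend on the order of the vertices.\<close>

definition has_Scarf_resolution :: "('v::finite, 'k::field) mpoly set \<Rightarrow> bool" where
  "has_Scarf_resolution J \<longleftrightarrow>
     (\<exists>r. linear_order_on (Gens J) r \<and> supports_resolution r (Scarf J) J)"

end

theory Submission
  imports Defs
begin

text \<open>
  For each of the four graphs the minimal generators of \<open>I\<^sup>t\<close> are the points of a finite lattice
  polygon, and the label of a set of generators is a box around the corresponding points.
  For the square the generators are \<open>a^i b^k c^(t - i) d^(t - k)\<close> with \<open>i, k \<le> t\<close>, so an lcm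
  records the maxima and the minima of both coordinates \<open>i\<close> and \<open>k\<close>, that is, the bounding box.
  The path has the same generators with \<open>b\<close> and \<open>d\<close> exchanged and only the points with
  \<open>i + k \<le> t\<close>; both are treated at once as down-closed parts of a grid. For the triangle and the
  claw the points are the triples \<open>i + j + k = t\<close>; an lcm records the three minima of the
  coordinates for the triangle and the three maxima for the claw.

  Everything about the Scarf complex follows from one observation (lemma \<open>Scarf_between\<close>): if \<open>p\<close> and
  \<open>q\<close> lie in a Scarf face and a generator \<open>u\<close> divides \<open>lcm(p, q)\<close>, then \<open>u\<close> is \<open>p\<close> or \<open>q\<close>, for
  otherwise adding or removing \<open>u\<close> would change the face but not its label. So two points of a
  face are the only points of the polygon in the box that they span. In a grid this
  forces them to be neighbours. For the triangle every box spanned by two points contains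
  three points, so there are no edges at all. For the claw
  the same happens unless both points lie on a common side of the polygon, where they must again
  be neighbours. Conversely neighbours do span Scarf edges (lemma \<open>Scarf_edge\<close>),
  and no three points are pairwise neighbours, so the complex has dimension at most one.

  Two obstructions exclude a resolution. A grid that contains a unit square has a
  nonzero cycle in homological degree 1, which is not a boundary because there are no faces of
  dimension 2 (lemma \<open>not_resolution_if_square\<close>). For the triangle and the claw already the syzygies
  of the generators are not generated by the edges: there are two
  generators \<open>u\<close>, \<open>w\<close> such that no Scarf edge at \<open>u\<close> has a label dividing \<open>lcm(u, w)\<close>
  (lemma \<open>not_resolution_if_isolated_syzygy\<close>).
\<close>

section \<open>Monomial ideals and their powers\<close>

definition mdvd :: "'v mono \<Rightarrow> 'v mono \<Rightarrow> bool" (infix "\<preceq>" 50) where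
  "u \<preceq> m \<longleftrightarrow> (\<forall>x. Poly_Mapping.lookup u x \<le> Poly_Mapping.lookup m x)"

lemma mdvd_refl [simp]: "u \<preceq> u"
  by (simp add: mdvd_def)

lemma mdvd_trans: "u \<preceq> v \<Longrightarrow> v \<preceq> w \<Longrightarrow> u \<preceq> w"
  by (auto simp: mdvd_def intro: order_trans)

lemma mdvd_antisym: "u \<preceq> v \<Longrightarrow> v \<preceq> u \<Longrightarrow> u = v"
  by (auto simp: mdvd_def intro!: poly_mapping_eqI order_antisym)

lemma mdvd_add_mono: "u \<preceq> u' \<Longrightarrow> v \<preceq> v' \<Longrightarrow> u + v \<preceq> u' + v'"
  by (simp add: mdvd_def lookup_add add_mono)

lemma add_diff_mdvd: "u \<preceq> m \<Longrightarrow> u + (m - u) = m"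
  by (auto simp: mdvd_def lookup_add lookup_minus intro!: poly_mapping_eqI)

lemma mon_mult: "mon u * mon v = (mon (u + v) :: ('v, 'k::field) mpoly)"
  by (simp add: mon_def mult_single)

lemma mon_nonzero [simp]: "(mon m :: ('v, 'k::field) mpoly) \<noteq> 0"
  by (metis lookup_single_eq lookup_zero mon_def one_neq_zero)

text \<open>Membership in a monomial ideal can be tested on the support: the polynomials all of whose
  monomials are multiples of elements of \<open>A\<close> form an ideal, and each of them is the sum of its terms.\<close>

lemma ideal_mon:
  fixes A :: "'v mono set"
  shows "ideal (mon ` A) = {f :: ('v, 'k::field) mpoly. \<forall>m\<in>Poly_Mapping.keys f. \<exists>u\<in>A. u \<preceq> m}"
    (is "_ = ?R")
proof
  interpret m: module "(*) :: ('v, 'k) mpoly \<Rightarrow> _" by (rule module_times)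
  have sub: "m.subspace ?R"
    unfolding m.subspace_def
  proof (intro conjI ballI allI)
    show "0 \<in> ?R" by simp
  next
    fix f g assume "f \<in> ?R" "g \<in> ?R"
    then show "f + g \<in> ?R"
      using Poly_Mapping.keys_add[of f g] by blast
  next
    fix c f assume f: "f \<in> ?R"
    show "c * f \<in> ?R"
    proof (clarsimp)
      fix m assume "m \<in> Poly_Mapping.keys (c * f)"
      then obtain p q where "m = p + q" "q \<in> Poly_Mapping.keys f"
        using keys_mult[of c f] by blast
      moreover obtain u where "u \<in> A" "u \<preceq> q" using f \<open>q \<in> _\<close> by blast
      moreover have "q \<preceq> m" using \<open>m = p + q\<close> by (simp add: mdvd_def lookup_add)
      ultimately show "\<exists>u\<in>A. u \<preceq> m" using mdvd_trans by blast
    qed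
  qed
  have "mon ` A \<subseteq> ?R"
    by (auto simp: mon_def intro: mdvd_refl)
  then show "ideal (mon ` A) \<subseteq> ?R"
    unfolding ideal_def by (rule m.span_minimal[OF _ sub])
  show "?R \<subseteq> ideal (mon ` A)"
  proof
    fix f assume f: "f \<in> ?R"
    have "Poly_Mapping.single m (Poly_Mapping.lookup f m) \<in> m.span (mon ` A)"
      if m: "m \<in> Poly_Mapping.keys f" for m
    proof -
      obtain u where u: "u \<in> A" "u \<preceq> m" using f m by blast
      have "Poly_Mapping.single m (Poly_Mapping.lookup f m)
          = Poly_Mapping.single (m - u) (Poly_Mapping.lookup f m) * mon u"
        using add_diff_mdvd[OF u(2)] by (simp add: mon_def mult_single add.commute)
      then show ?thesis using u(1) by (simp add: m.span_base m.span_scale)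
    qed
    then have "(\<Sum>m\<in>Poly_Mapping.keys f. Poly_Mapping.single m (Poly_Mapping.lookup f m)) \<in> m.span (mon ` A)"
      by (intro m.span_sum)
    moreover have "(\<Sum>m\<in>Poly_Mapping.keys f. Poly_Mapping.single m (Poly_Mapping.lookup f m)) = f"
      by (rule poly_mapping_eqI) (auto simp: lookup_sum lookup_single when_def in_keys_iff sum.delta)
    ultimately show "f \<in> ideal (mon ` A)"
      by (simp add: ideal_def)
  qed
qed

lemma mon_in_ideal_iff:
  "(mon m :: ('v, 'k::field) mpoly) \<in> ideal (mon ` A) \<longleftrightarrow> (\<exists>u\<in>A. u \<preceq> m)"
  by (simp add: ideal_mon) (simp add: mon_def)

lemma mon_in_ideal: "u \<in> A \<Longrightarrow> (mon u :: ('v, 'k::field) mpoly) \<in> ideal (mon ` A)"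
  using mdvd_refl unfolding mon_in_ideal_iff by blast

text \<open>A minimal generating set \<open>N\<close> of the same ideal contains \<open>M\<close>: each \<open>m \<in> M\<close> is a multiple of some
  \<open>u \<in> N\<close>, which is a multiple of some element of \<open>M\<close>, and the antichain condition collapses this
  chain to \<open>u = m\<close>.\<close>

lemma Gens_ideal_mon:
  assumes antichain: "\<And>u v. u \<in> M \<Longrightarrow> v \<in> M \<Longrightarrow> u \<preceq> v \<Longrightarrow> u = v"
  shows "Gens (ideal (mon ` M) :: ('v, 'k::field) mpoly set) = M"
  unfolding Gens_def
proof (rule the_equality)
  let ?J = "ideal (mon ` M) :: ('v, 'k) mpoly set"
  have "ideal (mon ` M') \<noteq> ?J" if M': "M' \<subset> M" for M'
  proof
    assume eq: "ideal (mon ` M') = ?J"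
    obtain m where m: "m \<in> M" "m \<notin> M'" using M' by blast
    have "mon m \<in> ?J" using m(1) by (rule mon_in_ideal)
    then obtain u where "u \<in> M'" "u \<preceq> m" unfolding eq[symmetric] mon_in_ideal_iff by blast
    then show False using antichain m M' by blast
  qed
  then show min: "minimal_monomial_gens ?J M"
    by (auto simp: minimal_monomial_gens_def)
  fix N assume N: "minimal_monomial_gens ?J N"
  then have eq: "ideal (mon ` N) = ?J" by (simp add: minimal_monomial_gens_def)
  have "M \<subseteq> N"
  proof
    fix m assume m: "m \<in> M"
    then have "mon m \<in> ?J" by (rule mon_in_ideal)
    then obtain u where u: "u \<in> N" "u \<preceq> m" unfolding eq[symmetric] mon_in_ideal_iff by blast
    then have "mon u \<in> ?J" unfolding eq[symmetric] by (intro mon_in_ideal)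
    then obtain m' where m': "m' \<in> M" "m' \<preceq> u" unfolding mon_in_ideal_iff by blast
    then have "m' = m" using antichain m u mdvd_trans by blast
    then have "u = m" using m' u mdvd_antisym by blast
    then show "m \<in> N" using u by simp
  qed
  then show "N = M"
    using N unfolding minimal_monomial_gens_def by blast
qed

primrec products :: "'v mono set \<Rightarrow> nat \<Rightarrow> 'v mono set" where
  "products A 0 = {0}"
| "products A (Suc t) = {u + v | u v. u \<in> products A t \<and> v \<in> A}"

lemma ideal_power_mon:
  "ideal_power (ideal (mon ` A)) t = (ideal (mon ` products A t) :: ('v, 'k::field) mpoly set)"
proof
  interpret m: module "(*) :: ('v, 'k) mpoly \<Rightarrow> _" by (rule module_times)
  let ?I = "ideal (mon ` A) :: ('v, 'k) mpoly set"
  have "(\<Prod>i<t. f i) \<in> ideal (mon ` products A t)" if "\<forall>i<t. f i \<in> ?I" for f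
    using that
  proof (induction t)
    case 0
    show ?case using mon_in_ideal[of 0 "{0}"] by (simp add: mon_def)
  next
    case (Suc t)
    let ?g = "\<Prod>i<t. f i"
    have IH: "?g \<in> ideal (mon ` products A t)" and ft: "f t \<in> ?I"
      using Suc by auto
    show ?case
      unfolding ideal_mon
    proof (clarsimp)
      fix m assume "m \<in> Poly_Mapping.keys (?g * f t)"
      then obtain p q where m: "m = p + q" "p \<in> Poly_Mapping.keys ?g" "q \<in> Poly_Mapping.keys (f t)"
        using keys_mult[of ?g "f t"] by blast
      obtain u where "u \<in> products A t" "u \<preceq> p" using IH m(2) unfolding ideal_mon by blast
      moreover obtain v where "v \<in> A" "v \<preceq> q" using ft m(3) unfolding ideal_mon by blast
      ultimately show "\<exists>w. (\<exists>u v. w = u + v \<and> u \<in> products A t \<and> v \<in> A) \<and> w \<preceq> m"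
        using m(1) mdvd_add_mono by blast
    qed
  qed
  then show "ideal_power ?I t \<subseteq> ideal (mon ` products A t)"
    unfolding ideal_power_def unfolding ideal_def
    by (intro m.span_minimal m.subspace_span) (auto simp: ideal_def)
  have "\<exists>f. (\<forall>i<t. f i \<in> ?I) \<and> mon w = (\<Prod>i<t. f i)" if "w \<in> products A t" for w
    using that
  proof (induction t arbitrary: w)
    case 0
    then show ?case by (simp add: mon_def)
  next
    case (Suc t)
    then obtain u v where w: "w = u + v" "u \<in> products A t" "v \<in> A" by auto
    obtain f where f: "\<forall>i<t. f i \<in> ?I" "mon u = (\<Prod>i<t. f i)" using Suc.IH[OF w(2)] by blast
    have "(\<Prod>i<Suc t. (f(t := mon v)) i) = mon w"
      using f(2) w(1) by (simp add: mon_mult[symmetric])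
    moreover have "\<forall>i<Suc t. (f(t := mon v)) i \<in> ?I"
      using f(1) w(3) by (auto simp: less_Suc_eq mon_in_ideal)
    ultimately show ?case by metis
  qed
  then show "ideal (mon ` products A t) \<subseteq> ideal_power ?I t"
    unfolding ideal_power_def unfolding ideal_def
    by (intro m.span_mono) (auto simp: ideal_def)
qed

lemma products_eqI:
  assumes "P 0 = {0}"
    and "\<And>t u v. u \<in> P t \<Longrightarrow> v \<in> A \<Longrightarrow> u + v \<in> P (Suc t)"
    and "\<And>t x. x \<in> P (Suc t) \<Longrightarrow> \<exists>u\<in>P t. \<exists>v\<in>A. x = u + v"
  shows "products A t = P t"
proof (induction t)
  case (Suc t)
  then show ?case using assms(2,3) by (simp, blast)
qed (simp add: assms(1))

lemma edge_ideal_mon: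
  "(edge_ideal E :: ('v::finite, 'k::field) mpoly set) = ideal (mon ` {Poly_Mapping.single x 1 + Poly_Mapping.single y 1 | x y. {x, y} \<in> E})"
proof -
  have "({var x * var y | x y. {x, y} \<in> E} :: ('v, 'k) mpoly set)
    = mon ` {Poly_Mapping.single x 1 + Poly_Mapping.single y 1 | x y. {x, y} \<in> E}"
    by (auto simp: var_def mon_mult image_iff)
  then show ?thesis unfolding edge_ideal_def by simp
qed

lemma Gens_edge_ideal_power:
  fixes E :: "'v::finite set set"
  defines "A \<equiv> {Poly_Mapping.single x 1 + Poly_Mapping.single y 1 | x y. {x, y} \<in> E}"
  assumes antichain: "\<And>u v. u \<in> products A t \<Longrightarrow> v \<in> products A t \<Longrightarrow> u \<preceq> v \<Longrightarrow> u = v"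
  shows "Gens (ideal_power (edge_ideal E :: ('v, 'k::field) mpoly set) t) = products A t"
  unfolding edge_ideal_mon ideal_power_mon A_def[symmetric]
  by (rule Gens_ideal_mon[OF antichain])

section \<open>Labels and faces of the Scarf complex\<close>

lemma lookup_label: "Poly_Mapping.lookup (label \<sigma>) x = (SUP u\<in>\<sigma>. Poly_Mapping.lookup u x)"
  by (simp add: label_def)

lemma label_empty [simp]: "label {} = 0"
  by (rule poly_mapping_eqI) (simp add: lookup_label)

lemma lookup_label_insert [simp]:
  "finite \<sigma> \<Longrightarrow> Poly_Mapping.lookup (label (insert u \<sigma>)) x
     = max (Poly_Mapping.lookup u x) (Poly_Mapping.lookup (label \<sigma>) x)"
  by (cases "\<sigma> = {}") (auto simp: lookup_label Sup_nat_def)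

lemma label_singleton [simp]: "label {u} = u"
  by (rule poly_mapping_eqI) simp

lemma label_mdvd_iff: "finite \<sigma> \<Longrightarrow> label \<sigma> \<preceq> m \<longleftrightarrow> (\<forall>u\<in>\<sigma>. u \<preceq> m)"
  by (induction \<sigma> rule: finite_induct) (auto simp: mdvd_def)

lemma mdvd_label: "finite \<sigma> \<Longrightarrow> u \<in> \<sigma> \<Longrightarrow> u \<preceq> label \<sigma>"
  using label_mdvd_iff[of \<sigma> "label \<sigma>"] by auto

lemma label_eqI:
  assumes "finite \<sigma>" "\<tau> \<subseteq> \<sigma>" "\<And>u. u \<in> \<sigma> \<Longrightarrow> u \<preceq> label \<tau>"
  shows "label \<tau> = label \<sigma>"
proof (rule mdvd_antisym)
  have "finite \<tau>" using assms finite_subset by blast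
  then show "label \<tau> \<preceq> label \<sigma>" using assms mdvd_label by (auto simp: label_mdvd_iff)
  show "label \<sigma> \<preceq> label \<tau>" using assms by (simp add: label_mdvd_iff)
qed

text \<open>Passing to the set of all generators that divide the label, or to a subset that still has the
  same label, are the only ways in which a face can fail to be determined by its label. For the
  converse, a face \<open>\<tau>\<close> with the label of \<open>\<sigma>\<close> lies in \<open>\<sigma>\<close>, and if it missed \<open>v \<in> \<sigma>\<close> then \<open>v\<close> could be
  removed from \<open>\<sigma>\<close> as well.\<close>

lemma Scarf_iff:
  fixes J :: "('v::finite, 'k::field) mpoly set"
  assumes fin: "finite (Gens J)"
  shows "\<sigma> \<in> Scarf J \<longleftrightarrow> \<sigma> \<subseteq> Gens J \<and> (\<forall>u\<in>Gens J. u \<preceq> label \<sigma> \<longrightarrow> u \<in> \<sigma>) \<and>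
    (\<forall>v\<in>\<sigma>. label (\<sigma> - {v}) \<noteq> label \<sigma>)" (is "_ \<longleftrightarrow> ?R")
proof
  assume S: "\<sigma> \<in> Scarf J"
  then have sub: "\<sigma> \<subseteq> Gens J" and uniq: "\<And>\<tau>. \<tau> \<subseteq> Gens J \<Longrightarrow> label \<tau> = label \<sigma> \<Longrightarrow> \<tau> = \<sigma>"
    by (auto simp: Scarf_def Taylor_def)
  have f: "finite \<sigma>" using fin sub finite_subset by blast
  have "u \<in> \<sigma>" if "u \<in> Gens J" "u \<preceq> label \<sigma>" for u
  proof -
    have "label \<sigma> = label (insert u \<sigma>)"
      using that f mdvd_label by (intro label_eqI) auto
    then have "insert u \<sigma> = \<sigma>"
      using sub that(1) by (intro uniq) (simp, rule sym)
    then show ?thesis by blast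
  qed
  moreover have "label (\<sigma> - {v}) \<noteq> label \<sigma>" if "v \<in> \<sigma>" for v
    using uniq[of "\<sigma> - {v}"] sub that by auto
  ultimately show ?R using sub by auto
next
  assume R: ?R
  then have f: "finite \<sigma>" using fin finite_subset by blast
  have "\<tau> = \<sigma>" if t: "\<tau> \<subseteq> Gens J" "label \<tau> = label \<sigma>" for \<tau>
  proof (rule ccontr)
    assume ne: "\<tau> \<noteq> \<sigma>"
    have ft: "finite \<tau>" using fin t finite_subset by blast
    have "\<tau> \<subseteq> \<sigma>"
    proof
      fix u assume "u \<in> \<tau>"
      then show "u \<in> \<sigma>" using R t mdvd_label[OF ft, of u] by auto
    qed
    with ne obtain v where v: "v \<in> \<sigma>" "v \<notin> \<tau>" by blast
    then have "label \<tau> \<preceq> label (\<sigma> - {v})"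
      using f ft \<open>\<tau> \<subseteq> \<sigma>\<close> by (auto simp: label_mdvd_iff intro!: mdvd_label)
    then have "label (\<sigma> - {v}) = label \<sigma>"
      using f t(2) by (intro label_eqI) (auto intro: mdvd_trans[OF mdvd_label[OF f]])
    then show False using R v by blast
  qed
  then show "\<sigma> \<in> Scarf J" using R by (auto simp: Scarf_def Taylor_def)
qed

text \<open>The generator \<open>u\<close> divides the label of every face containing \<open>p\<close> and \<open>q\<close>. Hence it belongs to
  \<open>\<sigma>\<close>, and unless it is \<open>p\<close> or \<open>q\<close> itself it can be removed again without changing the label.\<close>

lemma Scarf_between:
  assumes S: "\<sigma> \<in> Scarf J" and fin: "finite (Gens J)" and u: "u \<in> Gens J"
    and pq: "p \<in> \<sigma>" "q \<in> \<sigma>"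
    and le: "\<forall>x. Poly_Mapping.lookup u x \<le> max (Poly_Mapping.lookup p x) (Poly_Mapping.lookup q x)"
  shows "u = p \<or> u = q"
proof (rule ccontr)
  assume ne: "\<not> ?thesis"
  have f: "finite \<sigma>" using assms finite_subset by (auto simp: Scarf_def Taylor_def)
  have bound: "u \<preceq> label \<tau>" if "finite \<tau>" "p \<in> \<tau>" "q \<in> \<tau>" for \<tau>
    using mdvd_label[OF that(1,2)] mdvd_label[OF that(1,3)] le unfolding mdvd_def
    by (meson le_trans max.boundedI)
  have "u \<in> \<sigma>"
    using bound[OF f pq] S u by (auto simp: Scarf_iff[OF fin])
  moreover have "label (\<sigma> - {u}) = label \<sigma>"
  proof (rule label_eqI[OF f])
    fix v assume "v \<in> \<sigma>"
    show "v \<preceq> label (\<sigma> - {u})"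
    proof (cases "v = u")
      case True
      then show ?thesis using bound[of "\<sigma> - {u}"] f ne pq by auto
    next
      case False
      then show ?thesis using \<open>v \<in> \<sigma>\<close> f by (intro mdvd_label) auto
    qed
  qed auto
  ultimately show False using S by (auto simp: Scarf_iff[OF fin])
qed

lemma Scarf_vertices:
  assumes fin: "finite (Gens J)" and "0 \<notin> Gens J"
    and antichain: "\<And>u v. u \<in> Gens J \<Longrightarrow> v \<in> Gens J \<Longrightarrow> u \<preceq> v \<Longrightarrow> u = v"
  shows "{} \<in> Scarf J" and "v \<in> Gens J \<Longrightarrow> {v} \<in> Scarf J"
proof -
  have "u = 0" if "u \<preceq> 0" for u :: "'a mono"
    using that by (auto simp: mdvd_def intro: poly_mapping_eqI)
  then show "{} \<in> Scarf J" using assms by (auto simp: Scarf_iff)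
  show "{v} \<in> Scarf J" if "v \<in> Gens J"
    using that assms by (auto simp: Scarf_iff)
qed

text \<open>In an antichain neither of two generators can be dropped without changing the label, so only
  further divisors of the lcm can prevent the edge from being a face.\<close>

lemma Scarf_edge:
  assumes fin: "finite (Gens J)"
    and antichain: "\<And>u v. u \<in> Gens J \<Longrightarrow> v \<in> Gens J \<Longrightarrow> u \<preceq> v \<Longrightarrow> u = v"
    and pq: "p \<in> Gens J" "q \<in> Gens J" "p \<noteq> q"
    and closed: "\<And>u. u \<in> Gens J \<Longrightarrow>
      (\<forall>x. Poly_Mapping.lookup u x \<le> max (Poly_Mapping.lookup p x) (Poly_Mapping.lookup q x)) \<Longrightarrow> u = p \<or> u = q"
  shows "{p, q} \<in> Scarf J"
proof -
  have "label {p} \<noteq> label {p, q}" "label {q} \<noteq> label {p, q}"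
    using antichain pq by (metis finite.intros insertCI label_singleton mdvd_label)+
  moreover have "{p, q} - {p} = {q}" "{p, q} - {q} = {p}" using pq by auto
  ultimately show ?thesis
    using pq closed by (auto simp: Scarf_iff[OF fin] mdvd_def)
qed

section \<open>Obstructions to supporting a resolution\<close>

text \<open>With \<open>L = lcm(u, w)\<close>, the syzygy \<open>(L / u) e\<^sub>u - (L / w) e\<^sub>w\<close> would have to be a combination of
  boundaries of edges. The coefficient of \<open>e\<^sub>u\<close> in the boundary of an edge \<open>\<sigma>\<close> is a multiple of
  \<open>label \<sigma> / u\<close>, so the monomial \<open>L / u\<close> can only come from an edge at \<open>u\<close> whose label divides \<open>L\<close>.\<close>

lemma not_resolution_if_isolated_syzygy:
  fixes J :: "('v::finite, 'k::field) mpoly set"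
  assumes uw: "{u} \<in> \<Delta>" "{w} \<in> \<Delta>" "u \<noteq> w"
    and no_edge: "\<And>v. {u, v} \<in> \<Delta> \<Longrightarrow> v \<noteq> u \<Longrightarrow> v \<preceq> label {u, w} \<Longrightarrow> False"
  shows "\<not> supports_resolution r \<Delta> J"
proof
  assume res: "supports_resolution r \<Delta> J"
  let ?L = "label {u, w}"
  define f :: "('v, 'k) chain" where "f = Poly_Mapping.single {u} (mon (?L - u)) - Poly_Mapping.single {w} (mon (?L - w))"
  have uL: "u \<preceq> ?L" and wL: "w \<preceq> ?L" by (auto intro: mdvd_label)
  have lk: "Poly_Mapping.lookup f {u} = mon (?L - u)" "Poly_Mapping.lookup f {w} = - mon (?L - w)"
    using uw(3) by (simp_all add: f_def lookup_minus lookup_single when_def)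
  have keys: "Poly_Mapping.keys f = {{u}, {w}}"
  proof
    show "Poly_Mapping.keys f \<subseteq> {{u}, {w}}"
    proof
      fix \<sigma> assume s: "\<sigma> \<in> Poly_Mapping.keys f"
      show "\<sigma> \<in> {{u}, {w}}"
      proof (rule ccontr)
        assume "\<sigma> \<notin> {{u}, {w}}"
        then have "{u} \<noteq> \<sigma>" "{w} \<noteq> \<sigma>" by auto
        then show False using s by (simp add: in_keys_iff f_def lookup_minus lookup_single)
      qed
    qed
    show "{{u}, {w}} \<subseteq> Poly_Mapping.keys f"
      using lk by (auto simp: in_keys_iff simp del: label_singleton)
  qed
  have "f \<in> chains \<Delta> 0" using uw by (auto simp: chains_def keys)
  moreover have "augmentation f = 0"
    unfolding augmentation_def keys using uw(3)
    by (simp add: lk mon_mult add_diff_mdvd[OF uL] add_diff_mdvd[OF wL])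
  ultimately obtain g where g: "g \<in> chains \<Delta> 1" "f = boundary r g"
    using res unfolding supports_resolution_def by blast
  let ?c = "\<lambda>\<sigma> x. face_sign r x \<sigma> * mon (label \<sigma> - label (\<sigma> - {x})) * Poly_Mapping.lookup g \<sigma>"
  \<comment> \<open>look at the monomial \<open>L / u\<close> in the coefficient of \<open>e\<^sub>u\<close>\<close>
  have coeff: "Poly_Mapping.lookup (Poly_Mapping.lookup (boundary r g) {u}) (?L - u) = 1"
    unfolding g(2)[symmetric] lk(1) by (simp add: mon_def)
  have "(\<Sum>\<sigma>\<in>Poly_Mapping.keys g. \<Sum>x\<in>\<sigma>.
      Poly_Mapping.lookup (Poly_Mapping.lookup (Poly_Mapping.single (\<sigma> - {x}) (?c \<sigma> x)) {u}) (?L - u)) \<noteq> 0"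
    using coeff by (simp add: boundary_def lookup_sum)
  then obtain \<sigma> x where s: "\<sigma> \<in> Poly_Mapping.keys g" "x \<in> \<sigma>"
      "Poly_Mapping.lookup (Poly_Mapping.lookup (Poly_Mapping.single (\<sigma> - {x}) (?c \<sigma> x)) {u}) (?L - u) \<noteq> 0"
    by (metis (no_types, lifting) sum.not_neutral_contains_not_neutral)
  then have su: "\<sigma> - {x} = {u}" and key: "?L - u \<in> Poly_Mapping.keys (?c \<sigma> x)"
    by (auto simp: lookup_single when_def in_keys_iff split: if_splits)
  interpret m: module "(*) :: ('v, 'k) mpoly \<Rightarrow> _" by (rule module_times)
  have \<sigma>: "\<sigma> = {u, x}" "x \<noteq> u" using su s(2) by auto
  have "\<sigma> \<in> \<Delta>" using g(1) s(1) by (auto simp: chains_def)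
  have "?c \<sigma> x = (face_sign r x \<sigma> * Poly_Mapping.lookup g \<sigma>) * mon (label \<sigma> - label (\<sigma> - {x}))"
    by (simp only: mult_ac)
  moreover have "\<dots> \<in> ideal (mon ` {label \<sigma> - label (\<sigma> - {x})})"
    unfolding ideal_def by (intro m.span_scale m.span_base) simp
  ultimately have "?c \<sigma> x \<in> ideal (mon ` {label \<sigma> - label (\<sigma> - {x})})"
    by (simp only:)
  then have "label \<sigma> - u \<preceq> ?L - u"
    using key su unfolding ideal_mon by auto
  moreover have "u \<preceq> label \<sigma>" by (simp add: \<sigma> mdvd_label)
  ultimately have "label \<sigma> \<preceq> ?L"
    using mdvd_add_mono[of u u "label \<sigma> - u" "?L - u"] by (simp add: add_diff_mdvd uL)
  then have "x \<preceq> ?L" using \<sigma> by (auto simp: label_mdvd_iff)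
  then show False using no_edge[of x] \<sigma> \<open>\<sigma> \<in> \<Delta>\<close> by auto
qed

lemma boundary_zero [simp]: "boundary r 0 = 0"
  by (simp add: boundary_def)

lemma boundary_superset:
  assumes "finite K" "Poly_Mapping.keys f \<subseteq> K"
  shows "boundary r f = (\<Sum>\<sigma>\<in>K. \<Sum>u\<in>\<sigma>. Poly_Mapping.single (\<sigma> - {u})
     (face_sign r u \<sigma> * mon (label \<sigma> - label (\<sigma> - {u})) * Poly_Mapping.lookup f \<sigma>))"
  unfolding boundary_def
  by (rule sum.mono_neutral_left) (use assms in \<open>auto simp: in_keys_iff\<close>)

lemma boundary_add: "boundary r (f + g) = boundary r f + boundary r g"
proof -
  let ?K = "Poly_Mapping.keys f \<union> Poly_Mapping.keys g"
  have "Poly_Mapping.keys (f + g) \<subseteq> ?K" by (rule Poly_Mapping.keys_add)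
  then show ?thesis
    by (simp add: boundary_superset[of ?K] lookup_add distrib_left single_add sum.distrib)
qed

text \<open>Rescaling edges and vertices to a common multiple \<open>M\<close> turns the homogenized boundary into the
  ordinary one: with \<open>E\<^sub>v = (M / v) e\<^sub>v\<close>, the rescaled edge from \<open>v\<close> to \<open>w\<close> is sent to \<open>E\<^sub>w - E\<^sub>v\<close>. The
  factor \<open>1\<close> or \<open>-1\<close> cancels the simplicial sign given by the order \<open>r\<close>.\<close>

lemma boundary_edge:
  fixes v w M :: "'v::finite mono"
  assumes lin: "linear_order_on G r" and vw: "v \<in> G" "w \<in> G" "v \<noteq> w"
    and dv: "v \<preceq> M" "w \<preceq> M"
  shows "boundary r (Poly_Mapping.single {v, w} ((if (v, w) \<in> r then 1 else -1) * mon (M - label {v, w})))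
    = Poly_Mapping.single {w} (mon (M - w)) - Poly_Mapping.single {v} (mon (M - v) :: ('v, 'k::field) mpoly)"
proof -
  let ?e = "(if (v, w) \<in> r then 1 else -1) :: ('v, 'k) mpoly"
  have total: "(v, w) \<in> r \<longleftrightarrow> (w, v) \<notin> r"
    using lin vw by (auto simp: linear_order_on_def partial_order_on_def total_on_def antisym_def)
  have ne: "(?e * mon (M - label {v, w})) \<noteq> 0" by simp
  have sets: "{x \<in> {v, w}. x \<noteq> v \<and> (x, v) \<in> r} = (if (w, v) \<in> r then {w} else {})"
    "{x \<in> {v, w}. x \<noteq> w \<and> (x, w) \<in> r} = (if (v, w) \<in> r then {v} else {})"
    using vw(3) by auto
  have sg: "face_sign r v {v, w} = ?e" "face_sign r w {v, w} = - ?e"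
    unfolding face_sign_def sets using total by auto
  have ee: "?e * ?e = 1" by simp
  have lab: "label {v, w} \<preceq> M" using dv by (simp add: label_mdvd_iff)
  have shift: "mon (label {v, w} - x) * mon (M - label {v, w}) = (mon (M - x) :: ('v, 'k) mpoly)"
    if "x \<in> {v, w}" for x
  proof -
    have "x \<preceq> label {v, w}" using that by (intro mdvd_label) auto
    then have "label {v, w} - x + (M - label {v, w}) = M - x"
      using lab by (intro poly_mapping_eqI) (simp add: lookup_add lookup_minus mdvd_def del: lookup_label_insert)
    then show ?thesis by (simp add: mon_mult)
  qed
  have d: "{v, w} - {v} = {w}" "{v, w} - {w} = {v}" using vw(3) by auto
  have "boundary r (Poly_Mapping.single {v, w} (?e * mon (M - label {v, w})))
    = Poly_Mapping.single {w} (?e * mon (label {v, w} - w) * (?e * mon (M - label {v, w})))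
    + Poly_Mapping.single {v} (- ?e * mon (label {v, w} - v) * (?e * mon (M - label {v, w})))"
    unfolding boundary_def using ne vw(3) by (simp add: sg d del: mult_eq_0_iff)
  also have "?e * mon (label {v, w} - w) * (?e * mon (M - label {v, w})) = mon (M - w)"
    using ee shift[of w] by (simp add: mult_ac) 
  also have "- ?e * mon (label {v, w} - v) * (?e * mon (M - label {v, w})) = - mon (M - v)"
    using ee shift[of v] by (simp add: mult_ac) 
  finally show ?thesis by (simp add: single_uminus)
qed

text \<open>Rescaled to the lcm of the four vertices, the edges of a square sum to a nonzero chain whose
  boundary telescopes to 0. It could only be the boundary of a chain of faces with three vertices.\<close>

lemma not_resolution_if_square:
  fixes J :: "('v::finite, 'k::field) mpoly set"
  assumes lin: "linear_order_on G r" and sub: "\<Delta> \<subseteq> Pow G"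
    and no_triangles: "\<And>\<sigma>. \<sigma> \<in> \<Delta> \<Longrightarrow> card \<sigma> \<noteq> 3"
    and edges: "{p, q} \<in> \<Delta>" "{q, s} \<in> \<Delta>" "{s, u} \<in> \<Delta>" "{u, p} \<in> \<Delta>"
    and dist: "distinct [p, q, s, u]"
  shows "\<not> supports_resolution r \<Delta> J"
proof
  assume res: "supports_resolution r \<Delta> J"
  define M where "M = label {p, q, s, u}"
  define h :: "_ \<Rightarrow> _ \<Rightarrow> ('v, 'k) chain" where
    "h v w = Poly_Mapping.single {v, w} ((if (v, w) \<in> r then 1 else -1) * mon (M - label {v, w}))" for v w
  define f where "f = h p q + h q s + h s u + h u p"
  have G: "p \<in> G" "q \<in> G" "s \<in> G" "u \<in> G" using edges sub by auto
  have dv: "p \<preceq> M" "q \<preceq> M" "s \<preceq> M" "u \<preceq> M" unfolding M_def by (auto intro!: mdvd_label)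
  have bh: "boundary r (h v w) = Poly_Mapping.single {w} (mon (M - w)) - Poly_Mapping.single {v} (mon (M - v))"
    if "v \<in> {p, q, s, u}" "w \<in> {p, q, s, u}" "v \<noteq> w" for v w
    unfolding h_def using that G dv by (intro boundary_edge[OF lin]) auto
  have "boundary r f = 0"
    unfolding f_def using dist by (auto simp: boundary_add bh)
  moreover have "f \<in> chains \<Delta> 1"
  proof -
    have "Poly_Mapping.keys (h v w) \<subseteq> {{v, w}}" for v w by (simp add: h_def)
    then have "Poly_Mapping.keys f \<subseteq> {{p, q}} \<union> {{q, s}} \<union> {{s, u}} \<union> {{u, p}}"
      unfolding f_def by (intro subset_trans[OF Poly_Mapping.keys_add] Un_mono)
    moreover have "\<sigma> \<in> \<Delta> \<and> card \<sigma> = Suc 1"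
      if "\<sigma> \<in> {{p, q}} \<union> {{q, s}} \<union> {{s, u}} \<union> {{u, p}}" for \<sigma>
      using that edges dist by auto
    ultimately show ?thesis unfolding chains_def by blast
  qed
  ultimately obtain g where g: "g \<in> chains \<Delta> (Suc 1)" "f = boundary r g"
    using res unfolding supports_resolution_def by blast
  have "Poly_Mapping.keys g = {}" using g(1) no_triangles by (fastforce simp: chains_def)
  then have "f = 0" using g(2) by simp
  moreover have "Poly_Mapping.lookup f {p, q} \<noteq> 0"
  proof -
    have "{q, s} \<noteq> {p, q}" "{s, u} \<noteq> {p, q}" "{u, p} \<noteq> {p, q}"
      using dist by (auto simp: doubleton_eq_iff)
    then have "Poly_Mapping.lookup f {p, q} = (if (p, q) \<in> r then 1 else -1) * mon (M - label {p, q})"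
      unfolding f_def h_def by (simp only: lookup_add lookup_single when_def if_False if_True simp_thms add_0_right)
    then show ?thesis by simp
  qed
  ultimately show False by simp
qed

section \<open>Monomials in three and four variables\<close>

definition mono3 :: "'v \<Rightarrow> 'v \<Rightarrow> 'v \<Rightarrow> nat \<Rightarrow> nat \<Rightarrow> nat \<Rightarrow> 'v mono" where
  "mono3 a b c i j k = Poly_Mapping.single a i + Poly_Mapping.single b j + Poly_Mapping.single c k"

locale three_variables =
  fixes a b c :: "'v::finite"
  assumes vars_distinct: "distinct [a, b, c]" and vars_UNIV: "UNIV = {a, b, c}"
begin

lemma all_vars: "(\<forall>x. P x) \<longleftrightarrow> P a \<and> P b \<and> P c"
  using vars_UNIV by (metis UNIV_I empty_iff insert_iff)

lemma lookup_mono3 [simp]: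
  "Poly_Mapping.lookup (mono3 a b c i j k) a = i"
  "Poly_Mapping.lookup (mono3 a b c i j k) b = j"
  "Poly_Mapping.lookup (mono3 a b c i j k) c = k"
  using vars_distinct by (auto simp: mono3_def lookup_add lookup_single when_def)

lemma mono3_mdvd_iff [simp]:
  "mono3 a b c i j k \<preceq> mono3 a b c i' j' k' \<longleftrightarrow> i \<le> i' \<and> j \<le> j' \<and> k \<le> k'"
  by (simp add: mdvd_def all_vars)

lemma mono3_eq_iff [simp]:
  "mono3 a b c i j k = mono3 a b c i' j' k' \<longleftrightarrow> i = i' \<and> j = j' \<and> k = k'"
  by (metis lookup_mono3)

lemma mono3_add [simp]:
  "mono3 a b c i j k + mono3 a b c i' j' k' = mono3 a b c (i + i') (j + j') (k + k')"
  by (simp add: mono3_def single_add ac_simps)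

lemma mono3_eq_0_iff [simp]: "0 = mono3 a b c i j k \<longleftrightarrow> i = 0 \<and> j = 0 \<and> k = 0"
  using mono3_eq_iff[of 0 0 0 i j k] by (auto simp: mono3_def)

end

locale four_variables =
  fixes a b c d :: "'v::finite"
  assumes vars_distinct: "distinct [a, b, c, d]" and vars_UNIV: "UNIV = {a, b, c, d}"
begin

lemma all_vars: "(\<forall>x. P x) \<longleftrightarrow> P a \<and> P b \<and> P c \<and> P d"
  using vars_UNIV by (metis UNIV_I empty_iff insert_iff)

lemma lookup_mono4 [simp]:
  "Poly_Mapping.lookup (mono4 a b c d i j k l) a = i"
  "Poly_Mapping.lookup (mono4 a b c d i j k l) b = j"
  "Poly_Mapping.lookup (mono4 a b c d i j k l) c = k"
  "Poly_Mapping.lookup (mono4 a b c d i j k l) d = l"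
  using vars_distinct by (auto simp: mono4_def lookup_add lookup_single when_def)

lemma mono4_mdvd_iff [simp]:
  "mono4 a b c d i j k l \<preceq> mono4 a b c d i' j' k' l' \<longleftrightarrow> i \<le> i' \<and> j \<le> j' \<and> k \<le> k' \<and> l \<le> l'"
  by (simp add: mdvd_def all_vars)

lemma mono4_eq_iff [simp]:
  "mono4 a b c d i j k l = mono4 a b c d i' j' k' l' \<longleftrightarrow> i = i' \<and> j = j' \<and> k = k' \<and> l = l'"
  by (metis lookup_mono4)

lemma mono4_add [simp]:
  "mono4 a b c d i j k l + mono4 a b c d i' j' k' l' = mono4 a b c d (i + i') (j + j') (k + k') (l + l')"
  by (simp add: mono4_def single_add ac_simps)

lemma mono4_eq_0_iff [simp]: "0 = mono4 a b c d i j k l \<longleftrightarrow> i = 0 \<and> j = 0 \<and> k = 0 \<and> l = 0"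
  using mono4_eq_iff[of 0 0 0 0 i j k l] by (auto simp: mono4_def)

end

section \<open>Down-closed parts of a grid: the square and the path\<close>

lemma grid_distance_1_iff:
  "\<bar>int i - int i'\<bar> + \<bar>int k - int k'\<bar> = 1 \<longleftrightarrow>
   i = i' \<and> (k' = Suc k \<or> k = Suc k') \<or> k = k' \<and> (i' = Suc i \<or> i = Suc i')"
  by (cases i i' rule: linorder_cases; cases k k' rule: linorder_cases) auto

text \<open>Translates between the exponents \<open>t - i\<close> of an lcm and the minimum of the coordinates \<open>i\<close>.\<close>

lemma truncated_diff_le_max_iff:
  fixes t :: nat
  assumes "x \<le> t" "i \<le> t" "i' \<le> t"
  shows "t - x \<le> max (t - i) (t - i') \<longleftrightarrow> min i i' \<le> x"
  using assms by auto

text \<open>The generators are indexed by a down-closed set of lattice points. The exponents \<open>i, k, t - i, t - k\<close>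
  make an lcm the bounding box of the points involved. Down-closedness provides the corners of a
  bounding box that are needed below.\<close>

locale grid = four_variables a b c d for a b c d :: "'v::finite" +
  fixes D :: "(nat \<times> nat) set" and t :: nat and J :: "('v, 'k::field) mpoly set"
  assumes t_pos: "t \<ge> 1"
    and D_le: "(i, k) \<in> D \<Longrightarrow> i \<le> t \<and> k \<le> t"
    and D_down: "(i, k) \<in> D \<Longrightarrow> i' \<le> i \<Longrightarrow> k' \<le> k \<Longrightarrow> (i', k') \<in> D"
    and Gens_J: "Gens J = {mono4 a b c d i k (t - i) (t - k) | i k. (i, k) \<in> D}"
begin

abbreviation "pt i k \<equiv> mono4 a b c d i k (t - i) (t - k)"

lemma inj_pt: "inj_on (\<lambda>(i, k). pt i k) D"
  by (auto simp: inj_on_def)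

lemma pt_in_Gens_iff: "pt i k \<in> Gens J \<longleftrightarrow> (i, k) \<in> D"
  by (auto simp: Gens_J)

lemma finite_Gens: "finite (Gens J)"
proof -
  have "D \<subseteq> {..t} \<times> {..t}" using D_le by auto
  then have "finite D" by (rule finite_subset) auto
  moreover have "Gens J = (\<lambda>(i, k). pt i k) ` D" by (auto simp: Gens_J)
  ultimately show ?thesis by simp
qed

lemma zero_notin_Gens: "0 \<notin> Gens J"
  using t_pos by (auto simp: Gens_J)

lemma antichain_Gens: "u \<in> Gens J \<Longrightarrow> v \<in> Gens J \<Longrightarrow> u \<preceq> v \<Longrightarrow> u = v"
  by (auto simp: Gens_J dest!: D_le)

text \<open>If both coordinates differ, some corner of the bounding box of the two points lies below one of
  them, hence in \<open>D\<close>, and is a third point in the box; if only one coordinate differs, the point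
  next to the smaller one must be the larger one.\<close>

lemma adjacent_if_Scarf:
  assumes S: "\<sigma> \<in> Scarf J" and p: "pt i k \<in> \<sigma>" "(i, k) \<in> D" and q: "pt i' k' \<in> \<sigma>" "(i', k') \<in> D"
    and ne: "(i, k) \<noteq> (i', k')"
  shows "\<bar>int i - int i'\<bar> + \<bar>int k - int k'\<bar> = 1"
proof -
  have between: "(x, y) = (i, k) \<or> (x, y) = (i', k')"
    if "(x, y) \<in> D" "min i i' \<le> x" "x \<le> max i i'" "min k k' \<le> y" "y \<le> max k k'" for x y
  proof -
    have "pt x y = pt i k \<or> pt x y = pt i' k'"
      using S finite_Gens _ p(1) q(1)
    proof (rule Scarf_between)
      show "pt x y \<in> Gens J" using that(1) by (simp add: pt_in_Gens_iff)
      show "\<forall>z. Poly_Mapping.lookup (pt x y) z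
          \<le> max (Poly_Mapping.lookup (pt i k) z) (Poly_Mapping.lookup (pt i' k') z)"
        using that(3,5) truncated_diff_le_max_iff[of x t i i'] truncated_diff_le_max_iff[of y t k k']
          that(2,4) D_le[OF that(1)] D_le[OF p(2)] D_le[OF q(2)]
        unfolding all_vars lookup_mono4 by blast
    qed
    then show ?thesis by auto
  qed
  consider "i < i'" "k < k'" | "i' < i" "k' < k" | "i < i'" "k' < k" | "i' < i" "k < k'"
    | "k = k'" "i < i'" | "k = k'" "i' < i" | "i = i'" "k < k'" | "i = i'" "k' < k"
    using ne by (cases i i' rule: linorder_cases; cases k k' rule: linorder_cases) simp_all
  then show ?thesis
  proof cases
    case 1 then show ?thesis using between[of i k'] D_down[OF q(2), of i k'] by auto
  next
    case 2 then show ?thesis using between[of i k'] D_down[OF p(2), of i k'] by auto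
  next
    case 3 then show ?thesis using between[of i k'] D_down[OF p(2), of i k'] by auto
  next
    case 4 then show ?thesis using between[of i' k] D_down[OF p(2), of i' k] by auto
  next
    case 5 then show ?thesis using between[of "Suc i" k] D_down[OF q(2), of "Suc i" k] by auto
  next
    case 6 then show ?thesis using between[of "Suc i'" k] D_down[OF p(2), of "Suc i'" k] by auto
  next
    case 7 then show ?thesis using between[of i "Suc k"] D_down[OF q(2), of i "Suc k"] by auto
  next
    case 8 then show ?thesis using between[of i "Suc k'"] D_down[OF p(2), of i "Suc k'"] by auto
  qed
qed

lemma edge_in_Scarf:
  assumes D: "(i, k) \<in> D" "(i', k') \<in> D" and adj: "\<bar>int i - int i'\<bar> + \<bar>int k - int k'\<bar> = 1"
  shows "{pt i k, pt i' k'} \<in> Scarf J"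
proof (rule Scarf_edge[OF finite_Gens antichain_Gens])
  show "pt i k \<in> Gens J" "pt i' k' \<in> Gens J" using D by (simp_all add: pt_in_Gens_iff)
  show "pt i k \<noteq> pt i' k'" using adj by auto
  fix u assume "u \<in> Gens J" and le: "\<forall>x. Poly_Mapping.lookup u x
    \<le> max (Poly_Mapping.lookup (pt i k) x) (Poly_Mapping.lookup (pt i' k') x)"
  then obtain x y where u: "u = pt x y" "(x, y) \<in> D" by (auto simp: Gens_J)
  have box: "x \<le> max i i'" "y \<le> max k k'" "t - x \<le> max (t - i) (t - i')" "t - y \<le> max (t - k) (t - k')"
    using le by (simp_all add: all_vars u)
  have "min i i' \<le> x" "min k k' \<le> y"
    using box D_le[OF D(1)] D_le[OF D(2)] D_le[OF u(2)] by (metis truncated_diff_le_max_iff)+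
  with box(1,2) have "x = i \<and> y = k \<or> x = i' \<and> y = k'"
    using adj unfolding grid_distance_1_iff by (elim disjE conjE) auto
  then show "u = pt i k \<or> u = pt i' k'" using u(1) by auto
qed

lemma Scarf_cases:
  assumes S: "\<sigma> \<in> Scarf J"
  shows "\<sigma> \<in> graph_complex (Gens J) (grid_edges D pt)"
proof -
  have sub: "\<sigma> \<subseteq> Gens J" using S by (auto simp: Scarf_def Taylor_def)
  consider "\<sigma> = {}" | p where "\<sigma> = {p}" | p q where "p \<in> \<sigma>" "q \<in> \<sigma>" "p \<noteq> q" by blast
  then show ?thesis
  proof cases
    case 3
    then have "p \<in> Gens J" "q \<in> Gens J" using sub by auto
    then obtain i k i' k' where pq: "p = pt i k" "q = pt i' k'" "(i, k) \<in> D" "(i', k') \<in> D"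
      unfolding Gens_J by blast
    have adj: "\<bar>int i - int i'\<bar> + \<bar>int k - int k'\<bar> = 1"
      using 3 pq by (intro adjacent_if_Scarf[OF S]) auto
    have "u = p \<or> u = q" if "u \<in> \<sigma>" for u
    proof (rule ccontr)
      assume ne: "\<not> ?thesis"
      have "u \<in> Gens J" using sub that by auto
      then obtain x y where u: "u = pt x y" "(x, y) \<in> D" unfolding Gens_J by blast
      have "\<bar>int i - int x\<bar> + \<bar>int k - int y\<bar> = 1" "\<bar>int i' - int x\<bar> + \<bar>int k' - int y\<bar> = 1"
        using 3 pq that u ne by (auto intro!: adjacent_if_Scarf[OF S])
      \<comment> \<open>the grid graph is bipartite, so it has no triangles\<close>
      then show False using adj unfolding grid_distance_1_iff by (elim disjE conjE) simp_all
    qed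
    then have "\<sigma> = {pt i k, pt i' k'}" using 3 pq by blast
    then have "\<sigma> \<in> grid_edges D pt" using pq adj unfolding grid_edges_def by blast
    then show ?thesis by (simp add: graph_complex_def)
  qed (use sub in \<open>auto simp: graph_complex_def\<close>)
qed

lemma Scarf_eq: "Scarf J = graph_complex {pt i k | i k. (i, k) \<in> D} (grid_edges D pt)"
proof -
  have "graph_complex (Gens J) (grid_edges D pt) \<subseteq> Scarf J"
    using Scarf_vertices[OF finite_Gens zero_notin_Gens antichain_Gens]
    by (auto simp: graph_complex_def grid_edges_def edge_in_Scarf)
  then show ?thesis using Scarf_cases by (auto simp flip: Gens_J)
qed

lemma no_Scarf_resolution:
  assumes "(1, 1) \<in> D"
  shows "\<not> has_Scarf_resolution J"
proof -
  have D: "(0, 0) \<in> D" "(Suc 0, 0) \<in> D" "(0, Suc 0) \<in> D" using D_down[OF assms] by auto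
  have no3: "card \<sigma> \<noteq> 3" if "\<sigma> \<in> Scarf J" for \<sigma>
  proof -
    have "card {x, y} \<noteq> 3" for x y :: "'v mono" by (simp add: card_insert_if)
    then show ?thesis using Scarf_cases[OF that] by (auto simp: graph_complex_def grid_edges_def)
  qed
  have edges: "{pt 0 0, pt 1 0} \<in> Scarf J" "{pt 1 0, pt 1 1} \<in> Scarf J"
    "{pt 1 1, pt 0 1} \<in> Scarf J" "{pt 0 1, pt 0 0} \<in> Scarf J"
    by (rule edge_in_Scarf; simp add: D assms[simplified])+
  have sub: "Scarf J \<subseteq> Pow (Gens J)" by (auto simp: Scarf_def Taylor_def)
  have dist: "distinct [pt 0 0, pt 1 0, pt 1 1, pt 0 1]" by simp
  show ?thesis
    unfolding has_Scarf_resolution_def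
  proof clarify
    fix r assume lin: "linear_order_on (Gens J) r" and "supports_resolution r (Scarf J) J"
    then show False using not_resolution_if_square[OF lin sub no3 edges dist, of J] by blast
  qed
qed

end

lemma products_square:
  fixes a b c d :: "'v::finite"
  assumes "square E a b c d"
  shows "products {Poly_Mapping.single x 1 + Poly_Mapping.single y 1 | x y. {x, y} \<in> E} t
    = {mono4 a b c d i k (t - i) (t - k) | i k. i \<le> t \<and> k \<le> t}" (is "products ?A t = ?P t")
proof -
  interpret four_variables a b c d
    using assms by unfold_locales (auto simp: square_def)
  let ?S = "{mono4 a b c d 1 1 0 0, mono4 a b c d 0 1 1 0, mono4 a b c d 0 0 1 1, mono4 a b c d 1 0 0 1}"
  have A: "?A = ?S"
    using assms by (auto simp: square_def mono4_def doubleton_eq_iff ac_simps)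
  show ?thesis
    unfolding A
  proof (rule products_eqI)
    show "?P 0 = {0}" by (auto simp: mono4_def)
  next
    fix t u v assume uv: "u \<in> ?P t" "v \<in> ?S"
    from uv show "u + v \<in> ?P (Suc t)" by (auto simp: Suc_diff_le)
  next
    fix t x assume "x \<in> ?P (Suc t)"
    then obtain i k where x: "x = mono4 a b c d i k (Suc t - i) (Suc t - k)" "i \<le> Suc t" "k \<le> Suc t" by auto
    \<comment> \<open>split off an edge that keeps the remaining point in range\<close>
    let ?i = "if i = Suc t then 1 else 0 :: nat" and ?k = "if k = Suc t then 1 else 0 :: nat"
    have "x = mono4 a b c d (i - ?i) (k - ?k) (t - (i - ?i)) (t - (k - ?k)) + mono4 a b c d ?i ?k (1 - ?i) (1 - ?k)"
      using x by (auto simp: Suc_diff_le)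
    moreover have "i - ?i \<le> t" "k - ?k \<le> t" using x by auto
    moreover have "mono4 a b c d ?i ?k (1 - ?i) (1 - ?k) \<in> ?S"
      using x by auto
    ultimately show "\<exists>u\<in>?P t. \<exists>v\<in>?S. x = u + v"
      by blast
  qed
qed

lemma square_edge_ideal_grid:
  assumes "square E a b c d" "t \<ge> 1"
  shows "grid a b c d {(i, j). i \<le> t \<and> j \<le> t} t (ideal_power (edge_ideal E :: ('v::finite, 'k::field) mpoly set) t)"
proof -
  interpret four_variables a b c d
    using assms(1) by unfold_locales (auto simp: square_def)
  show ?thesis
  proof unfold_locales
    show "Gens (ideal_power (edge_ideal E :: ('v, 'k) mpoly set) t)
      = {mono4 a b c d i k (t - i) (t - k) | i k. (i, k) \<in> {(i, j). i \<le> t \<and> j \<le> t}}"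
      by (subst Gens_edge_ideal_power; unfold products_square[OF assms(1)]) auto
  qed (use assms(2) in auto)
qed

text \<open>In the order \<open>a, d, c, b\<close> of the variables, the path has the exponents of the square, with the edge
  \<open>{d, a}\<close> missing. That edge contributes \<open>(1, 1)\<close> to \<open>(i, k)\<close>; without it, \<open>i + k\<close> is the number of
  factors other than \<open>bc\<close>.\<close>

lemma products_path3:
  fixes a b c d :: "'v::finite"
  assumes "path3 E a b c d"
  shows "products {Poly_Mapping.single x 1 + Poly_Mapping.single y 1 | x y. {x, y} \<in> E} t
    = {mono4 a d c b i k (t - i) (t - k) | i k. i + k \<le> t}" (is "products ?A t = ?P t")
proof -
  interpret four_variables a d c b
    using assms by unfold_locales (auto simp: path3_def)
  let ?S = "{mono4 a d c b 1 0 0 1, mono4 a d c b 0 0 1 1, mono4 a d c b 0 1 1 0}"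
  have A: "?A = ?S"
    using assms by (auto simp: path3_def mono4_def doubleton_eq_iff ac_simps)
  show ?thesis
    unfolding A
  proof (rule products_eqI)
    show "?P 0 = {0}" by (auto simp: mono4_def)
  next
    fix t u v assume uv: "u \<in> ?P t" "v \<in> ?S"
    from uv show "u + v \<in> ?P (Suc t)" by (auto simp: Suc_diff_le)
  next
    fix t x assume "x \<in> ?P (Suc t)"
    then obtain i k where x: "x = mono4 a d c b i k (Suc t - i) (Suc t - k)" "i + k \<le> Suc t" by auto
    \<comment> \<open>split off an edge that keeps the remaining point in range\<close>
    let ?i = "if i + k = Suc t \<and> i > 0 then 1 else 0 :: nat" and ?k = "if k = Suc t then 1 else 0 :: nat"
    have "x = mono4 a d c b (i - ?i) (k - ?k) (t - (i - ?i)) (t - (k - ?k)) + mono4 a d c b ?i ?k (1 - ?i) (1 - ?k)"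
      using x by (auto simp: Suc_diff_le)
    moreover have "(i - ?i) + (k - ?k) \<le> t" using x by auto
    moreover have "mono4 a d c b ?i ?k (1 - ?i) (1 - ?k) \<in> ?S"
      using x by auto
    ultimately show "\<exists>u\<in>?P t. \<exists>v\<in>?S. x = u + v"
      by blast
  qed
qed

lemma path3_edge_ideal_grid:
  assumes "path3 E a b c d" "t \<ge> 1"
  shows "grid a d c b {(i, k). i + k \<le> t} t (ideal_power (edge_ideal E :: ('v::finite, 'k::field) mpoly set) t)"
proof -
  interpret four_variables a d c b
    using assms(1) by unfold_locales (auto simp: path3_def)
  show ?thesis
  proof unfold_locales
    show "Gens (ideal_power (edge_ideal E :: ('v, 'k) mpoly set) t)
      = {mono4 a d c b i k (t - i) (t - k) | i k. (i, k) \<in> {(i, k). i + k \<le> t}}"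
      by (subst Gens_edge_ideal_power; unfold products_path3[OF assms(1)]) auto
  qed (use assms(2) in auto)
qed

section \<open>The triangle\<close>

lemma card_triples: "card {(i, j, k). i + j + k = (t::nat)} = (t + 2 choose 2)"
proof -
  have "{(i, j, k). i + j + k = t} = (\<lambda>(m, i). (i, m - i, t - m)) ` (SIGMA m:{..t}. {..m})"
  proof (intro set_eqI iffI)
    fix x assume "x \<in> {(i, j, k). i + j + k = t}"
    then obtain i j k where "x = (i, j, k)" "i + j + k = t" by auto
    then have "x = (\<lambda>(m, i). (i, m - i, t - m)) (i + j, i)" "(i + j, i) \<in> (SIGMA m:{..t}. {..m})"
      by auto
    then show "x \<in> (\<lambda>(m, i). (i, m - i, t - m)) ` (SIGMA m:{..t}. {..m})" by blast
  qed auto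
  moreover have "inj_on (\<lambda>(m, i). (i, m - i, t - m)) (SIGMA m:{..t}. {..m})"
    by (auto simp: inj_on_def)
  ultimately have "card {(i, j, k). i + j + k = t} = (\<Sum>m\<le>t. Suc m)"
    by (simp add: card_image)
  also have "\<dots> = (t + 2 choose 2)"
    by (induction t) (simp_all add: numeral_2_eq_2)
  finally show ?thesis .
qed

text \<open>The edges of the triangle have exponents \<open>(1,1,0)\<close>, \<open>(0,1,1)\<close>, \<open>(1,0,1)\<close>, so recording for each
  vertex how often it is missed makes the triples \<open>i + j + k = t\<close> the natural index set. Since the
  exponents are \<open>t - i, t - j, t - k\<close>, an lcm records the minima of the coordinates.\<close>

locale triangle_power = three_variables a b c for a b c :: "'v::finite" +
  fixes t :: nat and J :: "('v, 'k::field) mpoly set"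
  assumes t_pos: "t \<ge> 1"
    and Gens_J: "Gens J = {mono3 a b c (t - i) (t - j) (t - k) | i j k. i + j + k = t}"
begin

abbreviation "pt i j k \<equiv> mono3 a b c (t - i) (t - j) (t - k)"

lemma pt_in_Gens: "i + j + k = t \<Longrightarrow> pt i j k \<in> Gens J"
  by (auto simp: Gens_J)

lemma Gens_image: "Gens J = (\<lambda>(i, j, k). pt i j k) ` {(i, j, k). i + j + k = t}"
  unfolding Gens_J image_def by (simp add: conj_commute)

lemma card_Gens: "card (Gens J) = (t + 2 choose 2)"
  unfolding Gens_image by (subst card_image) (auto simp: inj_on_def card_triples)

lemma finite_Gens: "finite (Gens J)"
  using card_Gens by (intro card_ge_0_finite) (simp add: zero_less_binomial)

text \<open>The coordinatewise minimum \<open>(x, y, z)\<close> of two distinct points has sum less than \<open>t\<close>. Raising any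
  one of its coordinates until the sum is \<open>t\<close> gives three distinct generators that divide the lcm,
  which is one more than \<open>p\<close> and \<open>q\<close> can account for.\<close>

lemma Scarf_isolated:
  assumes S: "\<sigma> \<in> Scarf J" and pq: "p \<in> \<sigma>" "q \<in> \<sigma>"
  shows "p = q"
proof (rule ccontr)
  assume ne: "p \<noteq> q"
  have "p \<in> Gens J" "q \<in> Gens J" using S pq by (auto simp: Scarf_def Taylor_def)
  then obtain i j k i' j' k' where p: "p = pt i j k" "i + j + k = t" and q: "q = pt i' j' k'" "i' + j' + k' = t"
    unfolding Gens_J by blast
  define x y z where "x = min i i'" and "y = min j j'" and "z = min k k'"
  have lt: "x + y + z < t"
    using p q ne by (auto simp: x_def y_def z_def min_def)
  have between: "pt l m n = p \<or> pt l m n = q" if "l + m + n = t" "x \<le> l" "y \<le> m" "z \<le> n" for l m n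
    using S finite_Gens pt_in_Gens[OF that(1)] pq
  proof (rule Scarf_between)
    show "\<forall>v. Poly_Mapping.lookup (pt l m n) v \<le> max (Poly_Mapping.lookup p v) (Poly_Mapping.lookup q v)"
      using truncated_diff_le_max_iff[of l t i i'] truncated_diff_le_max_iff[of m t j j']
        truncated_diff_le_max_iff[of n t k k'] that p(2) q(2)
      unfolding p(1) q(1) all_vars lookup_mono3 x_def y_def z_def by simp
  qed
  define X Y Z where "X = pt (t - y - z) y z" and "Y = pt x (t - x - z) z" and "Z = pt x y (t - x - y)"
  have "X = p \<or> X = q" "Y = p \<or> Y = q" "Z = p \<or> Z = q"
    using lt unfolding X_def Y_def Z_def by (intro between; simp)+
  moreover have "X \<noteq> Y" "Y \<noteq> Z" "X \<noteq> Z"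
    using lt unfolding X_def Y_def Z_def by auto
  ultimately show False by metis
qed

lemma Scarf_eq: "Scarf J = graph_complex (Gens J) {}"
proof
  have "0 \<notin> Gens J" using t_pos by (auto simp: Gens_J)
  moreover have "u = v" if "u \<in> Gens J" "v \<in> Gens J" "u \<preceq> v" for u v
    using that by (auto simp: Gens_J)
  ultimately show "graph_complex (Gens J) {} \<subseteq> Scarf J"
    using Scarf_vertices[of J] finite_Gens by (auto simp: graph_complex_def)
  show "Scarf J \<subseteq> graph_complex (Gens J) {}"
  proof
    fix \<sigma> assume S: "\<sigma> \<in> Scarf J"
    then have "\<sigma> \<subseteq> Gens J" by (auto simp: Scarf_def Taylor_def)
    moreover have "\<sigma> = {} \<or> (\<exists>p. \<sigma> = {p})" using Scarf_isolated[OF S] by blast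
    ultimately show "\<sigma> \<in> graph_complex (Gens J) {}" by (auto simp: graph_complex_def)
  qed
qed

lemma no_Scarf_resolution: "\<not> has_Scarf_resolution J"
proof -
  have "pt t 0 0 \<in> Gens J" "pt 0 t 0 \<in> Gens J" by (rule pt_in_Gens; simp)+
  then have "{pt t 0 0} \<in> Scarf J" "{pt 0 t 0} \<in> Scarf J"
    unfolding Scarf_eq graph_complex_def by blast+
  moreover have "pt t 0 0 \<noteq> pt 0 t 0" using t_pos by auto
  ultimately show ?thesis
    unfolding has_Scarf_resolution_def
    using not_resolution_if_isolated_syzygy[of "pt t 0 0" "Scarf J" "pt 0 t 0"] Scarf_isolated by blast
qed

end

lemma products_triangle:
  fixes a b c :: "'v::finite"
  assumes "triangle E a b c"
  shows "products {Poly_Mapping.single x 1 + Poly_Mapping.single y 1 | x y. {x, y} \<in> E} t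
    = {mono3 a b c (t - i) (t - j) (t - k) | i j k. i + j + k = t}" (is "products ?A t = ?P t")
proof -
  interpret three_variables a b c
    using assms by unfold_locales (auto simp: triangle_def)
  let ?S = "{mono3 a b c 0 1 1, mono3 a b c 1 0 1, mono3 a b c 1 1 0}"
  have A: "?A = ?S"
    using assms by (auto simp: triangle_def mono3_def doubleton_eq_iff ac_simps)
  show ?thesis
    unfolding A
  proof (rule products_eqI)
    show "?P 0 = {0}" by (auto simp: mono3_def)
  next
    fix t u v assume uv: "u \<in> ?P t" "v \<in> ?S"
    from uv obtain i j k where x: "u + v = mono3 a b c (t - i) (t - j) (t - k) + v" "i + j + k = t"
      and v: "v = mono3 a b c 0 1 1 \<or> v = mono3 a b c 1 0 1 \<or> v = mono3 a b c 1 1 0" by auto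
    have "u + v = mono3 a b c (Suc t - Suc i) (Suc t - j) (Suc t - k) \<or> u + v = mono3 a b c (Suc t - i) (Suc t - Suc j) (Suc t - k)
      \<or> u + v = mono3 a b c (Suc t - i) (Suc t - j) (Suc t - Suc k)"
      using x v by auto
    moreover have "Suc i + j + k = Suc t" "i + Suc j + k = Suc t" "i + j + Suc k = Suc t" using x by auto
    ultimately show "u + v \<in> ?P (Suc t)" by blast
  next
    fix t x assume "x \<in> ?P (Suc t)"
    then obtain i j k where x: "x = mono3 a b c (Suc t - i) (Suc t - j) (Suc t - k)" "i + j + k = Suc t" by auto
    \<comment> \<open>split off an edge belonging to the first positive coordinate\<close>
    let ?i = "if i > 0 then 1 else 0 :: nat" and ?j = "if i = 0 \<and> j > 0 then 1 else 0 :: nat"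
      and ?k = "if i = 0 \<and> j = 0 then 1 else 0 :: nat"
    have "x = mono3 a b c (t - (i - ?i)) (t - (j - ?j)) (t - (k - ?k)) + mono3 a b c (1 - ?i) (1 - ?j) (1 - ?k)"
      using x by auto
    moreover have "(i - ?i) + (j - ?j) + (k - ?k) = t" using x by auto
    moreover have "mono3 a b c (1 - ?i) (1 - ?j) (1 - ?k) \<in> ?S"
      using x by auto
    ultimately show "\<exists>u\<in>?P t. \<exists>v\<in>?S. x = u + v"
      by blast
  qed
qed

lemma triangle_power_edge_ideal:
  assumes "triangle E a b c" "t \<ge> 1"
  shows "triangle_power a b c t (ideal_power (edge_ideal E :: ('v::finite, 'k::field) mpoly set) t)"
proof -
  interpret three_variables a b c
    using assms(1) by unfold_locales (auto simp: triangle_def)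
  show ?thesis
  proof unfold_locales
    show "Gens (ideal_power (edge_ideal E :: ('v, 'k) mpoly set) t)
      = {mono3 a b c (t - i) (t - j) (t - k) | i j k. i + j + k = t}"
      by (subst Gens_edge_ideal_power; unfold products_triangle[OF assms(1)]) auto
  qed (use assms(2) in auto)
qed

section \<open>The claw\<close>

text \<open>The exponent of the centre \<open>a\<close> is always \<open>t\<close>, so a generator is given by the multiplicities
  \<open>(i, j, k)\<close> of the three edges, and these are also its exponents at the leaves.\<close>

locale claw_power = four_variables a b c d for a b c d :: "'v::finite" +
  fixes t :: nat and J :: "('v, 'k::field) mpoly set"
  assumes t_ge_2: "t \<ge> 2"
    and Gens_J: "Gens J = {mono4 a b c d t i j k | i j k. i + j + k = t}"
begin

abbreviation "pt \<equiv> mono4 a b c d t"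

text \<open>Adjacency along the boundary of the lattice triangle \<open>i + j + k = t\<close>: both points lie on the same
  side and are one step apart. On a side, one coordinate determines the point, so a single
  step condition is enough.\<close>

definition cyclic_neighbours :: "nat \<times> nat \<times> nat \<Rightarrow> nat \<times> nat \<times> nat \<Rightarrow> bool" where
  "cyclic_neighbours = (\<lambda>(i, j, k) (i', j', k').
     k = 0 \<and> k' = 0 \<and> (i = Suc i' \<or> i' = Suc i) \<or>
     i = 0 \<and> i' = 0 \<and> (j = Suc j' \<or> j' = Suc j) \<or>
     j = 0 \<and> j' = 0 \<and> (k = Suc k' \<or> k' = Suc k))"

lemma pt_in_Gens: "i + j + k = t \<Longrightarrow> pt i j k \<in> Gens J"
  by (auto simp: Gens_J)

lemma Gens_image: "Gens J = (\<lambda>(i, j, k). pt i j k) ` {(i, j, k). i + j + k = t}"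
  unfolding Gens_J image_def by (simp add: conj_commute)

lemma card_Gens: "card (Gens J) = (t + 2 choose 2)"
  unfolding Gens_image by (subst card_image) (auto simp: inj_on_def card_triples)

lemma finite_Gens: "finite (Gens J)"
  using card_Gens by (intro card_ge_0_finite) (simp add: zero_less_binomial)

lemma zero_notin_Gens: "0 \<notin> Gens J"
  using t_ge_2 by (auto simp: Gens_J)

lemma antichain_Gens: "u \<in> Gens J \<Longrightarrow> v \<in> Gens J \<Longrightarrow> u \<preceq> v \<Longrightarrow> u = v"
  by (auto simp: Gens_J)

text \<open>Now an lcm records the coordinatewise maximum \<open>(P, Q, R)\<close>, whose sum exceeds \<open>t\<close>. If all three
  are positive, the box below it contains at least three points. Otherwise both points lie on a
  side of the triangle, and the point next to one of them towards the other must be the other.\<close>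

lemma Scarf_pair:
  assumes S: "\<sigma> \<in> Scarf J" and p: "pt i j k \<in> \<sigma>" "i + j + k = t" and q: "pt i' j' k' \<in> \<sigma>" "i' + j' + k' = t"
    and ne: "(i, j, k) \<noteq> (i', j', k')"
  shows "cyclic_neighbours (i, j, k) (i', j', k')"
proof -
  have between: "(l, m, n) = (i, j, k) \<or> (l, m, n) = (i', j', k')"
    if "l + m + n = t" "l \<le> max i i'" "m \<le> max j j'" "n \<le> max k k'" for l m n
  proof -
    have "pt l m n = pt i j k \<or> pt l m n = pt i' j' k'"
      using S finite_Gens pt_in_Gens[OF that(1)] p(1) q(1)
    proof (rule Scarf_between)
      show "\<forall>v. Poly_Mapping.lookup (pt l m n) v
          \<le> max (Poly_Mapping.lookup (pt i j k) v) (Poly_Mapping.lookup (pt i' j' k') v)"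
        using that by (simp add: all_vars)
    qed
    then show ?thesis by auto
  qed
  define P Q R where "P = max i i'" and "Q = max j j'" and "R = max k k'"
  have gt: "P + Q + R > t"
    using p q ne by (auto simp: P_def Q_def R_def max_def)
  have "P = 0 \<or> Q = 0 \<or> R = 0"
  proof (rule ccontr)
    assume pos: "\<not> ?thesis"
    \<comment> \<open>a smaller box with positive sides and sum exactly \<open>t + 1\<close>, which exists as \<open>t + 1 \<ge> 3\<close>; lowering
      any one side by 1 gives a point of the polygon\<close>
    define x y z where "x = min P (t - 1)" and "y = min Q (t - x)" and "z = t + 1 - x - y"
    have xyz: "x + y + z = Suc t" "x \<ge> 1" "y \<ge> 1" "z \<ge> 1" "x \<le> P" "y \<le> Q" "z \<le> R"
      using pos gt t_ge_2 by (auto simp: x_def y_def z_def min_def)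
    have "(l, m, n) = (i, j, k) \<or> (l, m, n) = (i', j', k')"
      if "l + m + n = t" "l \<le> x" "m \<le> y" "n \<le> z" for l m n
      using that(1) order_trans[OF that(2) xyz(5)] order_trans[OF that(3) xyz(6)] order_trans[OF that(4) xyz(7)]
      unfolding P_def Q_def R_def by (rule between)
    from this[of "x - 1" y z] this[of x "y - 1" z] this[of x y "z - 1"] show False
      using xyz by auto
  qed
  then show ?thesis
  proof (elim disjE)
    assume "P = 0"
    then have z: "i = 0" "i' = 0" by (auto simp: P_def)
    show ?thesis
    proof (cases "j < j'")
      case True
      then show ?thesis using between[of 0 "Suc j" "k - 1"] p(2) q(2) z by (auto simp: cyclic_neighbours_def)
    next
      case False
      then show ?thesis using between[of 0 "Suc j'" "k' - 1"] p(2) q(2) ne z by (auto simp: cyclic_neighbours_def)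
    qed
  next
    assume "Q = 0"
    then have z: "j = 0" "j' = 0" by (auto simp: Q_def)
    show ?thesis
    proof (cases "k < k'")
      case True
      then show ?thesis using between[of "i - 1" 0 "Suc k"] p(2) q(2) z by (auto simp: cyclic_neighbours_def)
    next
      case False
      then show ?thesis using between[of "i' - 1" 0 "Suc k'"] p(2) q(2) ne z by (auto simp: cyclic_neighbours_def)
    qed
  next
    assume "R = 0"
    then have z: "k = 0" "k' = 0" by (auto simp: R_def)
    show ?thesis
    proof (cases "i < i'")
      case True
      then show ?thesis using between[of "Suc i" "j - 1" 0] p(2) q(2) z by (auto simp: cyclic_neighbours_def)
    next
      case False
      then show ?thesis using between[of "Suc i'" "j' - 1" 0] p(2) q(2) ne z by (auto simp: cyclic_neighbours_def)
    qed
  qed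
qed

text \<open>Neighbours are adjacent vertices of a cycle of length \<open>3 t\<close>, and such a cycle contains no
  triangle because \<open>t \<ge> 2\<close>.\<close>

lemma no_three_neighbours:
  assumes "i + j + k = t" "i' + j' + k' = t" "l + m + n = t"
    and "cyclic_neighbours (i, j, k) (i', j', k')" "cyclic_neighbours (i, j, k) (l, m, n)"
  shows "\<not> cyclic_neighbours (i', j', k') (l, m, n)"
  using assms t_ge_2 unfolding cyclic_neighbours_def by auto

lemma edge_in_Scarf:
  assumes p: "i + j + k = t" and q: "i' + j' + k' = t" and nb: "cyclic_neighbours (i, j, k) (i', j', k')"
  shows "{pt i j k, pt i' j' k'} \<in> Scarf J"
proof (rule Scarf_edge[OF finite_Gens antichain_Gens])
  show "pt i j k \<in> Gens J" "pt i' j' k' \<in> Gens J" using p q by (simp_all add: pt_in_Gens)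
  show "pt i j k \<noteq> pt i' j' k'" using nb by (auto simp: cyclic_neighbours_def)
  fix u assume "u \<in> Gens J" and le: "\<forall>x. Poly_Mapping.lookup u x
    \<le> max (Poly_Mapping.lookup (pt i j k) x) (Poly_Mapping.lookup (pt i' j' k') x)"
  then obtain l m n where u: "u = pt l m n" "l + m + n = t" by (auto simp: Gens_J)
  have "l \<le> max i i'" "m \<le> max j j'" "n \<le> max k k'"
    using le by (simp_all add: all_vars u)
  then have "(l, m, n) = (i, j, k) \<or> (l, m, n) = (i', j', k')"
    using nb p q u(2) by (auto simp: cyclic_neighbours_def)
  then show "u = pt i j k \<or> u = pt i' j' k'" using u(1) by auto
qed

definition "boundary_cycle = map (\<lambda>i. pt (t - i) i 0) [0..<t] @ map (\<lambda>i. pt 0 (t - i) i) [0..<t]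
                @ map (\<lambda>i. pt i 0 (t - i)) [0..<t]"

lemma length_boundary_cycle: "length boundary_cycle = 3 * t"
  by (simp add: boundary_cycle_def)

lemma distinct_boundary_cycle: "distinct boundary_cycle"
  by (auto simp: boundary_cycle_def distinct_map inj_on_def)

lemma set_boundary_cycle:
  "set boundary_cycle = {pt i j k | i j k. i + j + k = t \<and> (i = 0 \<or> j = 0 \<or> k = 0)}"
proof (intro set_eqI iffI)
  fix x assume "x \<in> {pt i j k | i j k. i + j + k = t \<and> (i = 0 \<or> j = 0 \<or> k = 0)}"
  then obtain i j k where x: "x = pt i j k" "i + j + k = t" "i = 0 \<or> j = 0 \<or> k = 0" by auto
  then have "k = 0 \<and> j < t \<and> x = pt (t - j) j 0 \<or> i = 0 \<and> k < t \<and> x = pt 0 (t - k) k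
      \<or> j = 0 \<and> i < t \<and> x = pt i 0 (t - i)"
    using t_ge_2 by auto
  then show "x \<in> set boundary_cycle" by (auto simp: boundary_cycle_def)
qed (auto simp: boundary_cycle_def)

text \<open>The case \<open>n = t\<close> is included: it says that each of the three segments of the list ends where
  the next one begins, the last one after reduction modulo the length. All edges of the cycle
  then have the same form, without exceptions at the corners.\<close>

lemma nth_boundary_cycle:
  assumes "n \<le> t"
  shows "boundary_cycle ! n = pt (t - n) n 0" "boundary_cycle ! (t + n) = pt 0 (t - n) n"
    "boundary_cycle ! ((2 * t + n) mod (3 * t)) = pt n 0 (t - n)"
proof -
  have [simp]: "(2 * t + n) mod (3 * t) = (if n = t then 0 else 2 * t + n)"
    using assms t_ge_2 by auto
  show "boundary_cycle ! n = pt (t - n) n 0" "boundary_cycle ! (t + n) = pt 0 (t - n) n"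
    "boundary_cycle ! ((2 * t + n) mod (3 * t)) = pt n 0 (t - n)"
    using assms t_ge_2 by (auto simp: boundary_cycle_def nth_append)
qed

lemma cycle_edges_boundary_cycle:
  "cycle_edges boundary_cycle = {{pt i j k, pt i' j' k'} | i j k i' j' k'.
     i + j + k = t \<and> i' + j' + k' = t \<and> cyclic_neighbours (i, j, k) (i', j', k')}" (is "_ = ?R")
proof -
  let ?L = boundary_cycle
  let ?e = "\<lambda>n. {?L ! n, ?L ! (Suc n mod (3 * t))}"
  have e: "?e n = {pt (t - n) n 0, pt (t - Suc n) (Suc n) 0}"
    "?e (t + n) = {pt 0 (t - n) n, pt 0 (t - Suc n) (Suc n)}"
    "?e (2 * t + n) = {pt n 0 (t - n), pt (Suc n) 0 (t - Suc n)}" if "n < t" for n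
    using nth_boundary_cycle[of n] nth_boundary_cycle[of "Suc n"] that t_ge_2 by simp_all
  have C: "cycle_edges ?L = ?e ` {..<3 * t}"
    by (auto simp: cycle_edges_def length_boundary_cycle)
  have split: "{..<3 * t} = {..<t} \<union> (\<lambda>n. t + n) ` {..<t} \<union> (\<lambda>n. 2 * t + n) ` {..<t}"
  proof (intro set_eqI iffI)
    fix x assume "x \<in> {..<3 * t}"
    then consider "x < t" | "x = t + (x - t)" "x - t < t" | "x = 2 * t + (x - 2 * t)" "x - 2 * t < t" 
      by fastforce
    then show "x \<in> {..<t} \<union> (\<lambda>n. t + n) ` {..<t} \<union> (\<lambda>n. 2 * t + n) ` {..<t}"
      by cases blast+
  qed auto
  have "cycle_edges ?L = (\<lambda>n. {pt (t - n) n 0, pt (t - Suc n) (Suc n) 0}) ` {..<t}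
      \<union> (\<lambda>n. {pt 0 (t - n) n, pt 0 (t - Suc n) (Suc n)}) ` {..<t}
      \<union> (\<lambda>n. {pt n 0 (t - n), pt (Suc n) 0 (t - Suc n)}) ` {..<t}" (is "_ = ?U")
    unfolding C split image_Un image_image
    by (intro arg_cong2[where f = "(\<union>)"] image_cong refl e) simp_all
  also have "?U = ?R"
  proof (intro set_eqI iffI)
    fix \<sigma> assume "\<sigma> \<in> ?U"
    then obtain n where n: "n < t" "\<sigma> = {pt (t - n) n 0, pt (t - Suc n) (Suc n) 0} \<or>
      \<sigma> = {pt 0 (t - n) n, pt 0 (t - Suc n) (Suc n)} \<or> \<sigma> = {pt n 0 (t - n), pt (Suc n) 0 (t - Suc n)}"
      by fast
    have "cyclic_neighbours (t - n, n, 0) (t - Suc n, Suc n, 0)"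
      "cyclic_neighbours (0, t - n, n) (0, t - Suc n, Suc n)"
      "cyclic_neighbours (n, 0, t - n) (Suc n, 0, t - Suc n)"
      using n(1) by (auto simp: cyclic_neighbours_def)
    moreover have "t - n + n + 0 = t" "t - Suc n + Suc n + 0 = t" "0 + (t - n) + n = t"
      "0 + (t - Suc n) + Suc n = t" "n + 0 + (t - n) = t" "Suc n + 0 + (t - Suc n) = t" using n(1) by auto
    ultimately show "\<sigma> \<in> ?R" using n(2) by blast
  next
    fix \<sigma> assume "\<sigma> \<in> ?R"
    then obtain i j k i' j' k' where s: "\<sigma> = {pt i j k, pt i' j' k'}" "i + j + k = t" "i' + j' + k' = t"
      and nb: "cyclic_neighbours (i, j, k) (i', j', k')" by blast
    have "\<exists>n<t. \<sigma> = {pt (t - n) n 0, pt (t - Suc n) (Suc n) 0} \<or>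
      \<sigma> = {pt 0 (t - n) n, pt 0 (t - Suc n) (Suc n)} \<or> \<sigma> = {pt n 0 (t - n), pt (Suc n) 0 (t - Suc n)}"
    proof -
      consider "k = 0" "k' = 0" "i = Suc i'" | "k = 0" "k' = 0" "i' = Suc i"
        | "i = 0" "i' = 0" "j = Suc j'" | "i = 0" "i' = 0" "j' = Suc j"
        | "j = 0" "j' = 0" "k = Suc k'" | "j = 0" "j' = 0" "k' = Suc k"
        using nb by (auto simp: cyclic_neighbours_def)
      then show ?thesis
      proof cases
        case 1
        then have "j < t" and eqs: "i = t - j" "i' = t - Suc j" "j' = Suc j" using s by auto
        have "\<sigma> = {pt (t - j) j 0, pt (t - Suc j) (Suc j) 0}"
          unfolding s(1) by (simp only: 1(1,2) eqs)
        then show ?thesis using \<open>j < t\<close> by blast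
      next
        case 2
        then have "j' < t" and eqs: "i' = t - j'" "i = t - Suc j'" "j = Suc j'" using s by auto
        have "\<sigma> = {pt (t - j') j' 0, pt (t - Suc j') (Suc j') 0}"
          unfolding s(1) by (simp only: 2(1,2) eqs insert_commute)
        then show ?thesis using \<open>j' < t\<close> by blast
      next
        case 3
        then have "k < t" and eqs: "j = t - k" "j' = t - Suc k" "k' = Suc k" using s by auto
        have "\<sigma> = {pt 0 (t - k) k, pt 0 (t - Suc k) (Suc k)}"
          unfolding s(1) by (simp only: 3(1,2) eqs)
        then show ?thesis using \<open>k < t\<close> by blast
      next
        case 4
        then have "k' < t" and eqs: "j' = t - k'" "j = t - Suc k'" "k = Suc k'" using s by auto
        have "\<sigma> = {pt 0 (t - k') k', pt 0 (t - Suc k') (Suc k')}"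
          unfolding s(1) by (simp only: 4(1,2) eqs insert_commute)
        then show ?thesis using \<open>k' < t\<close> by blast
      next
        case 5
        then have "i < t" and eqs: "k = t - i" "k' = t - Suc i" "i' = Suc i" using s by auto
        have "\<sigma> = {pt i 0 (t - i), pt (Suc i) 0 (t - Suc i)}"
          unfolding s(1) by (simp only: 5(1,2) eqs)
        then show ?thesis using \<open>i < t\<close> by blast
      next
        case 6
        then have "i' < t" and eqs: "k' = t - i'" "k = t - Suc i'" "i = Suc i'" using s by auto
        have "\<sigma> = {pt i' 0 (t - i'), pt (Suc i') 0 (t - Suc i')}"
          unfolding s(1) by (simp only: 6(1,2) eqs insert_commute)
        then show ?thesis using \<open>i' < t\<close> by blast
      qed
    qed
    then show "\<sigma> \<in> ?U" by fast
  qed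
  finally show ?thesis .
qed

lemma Scarf_eq: "Scarf J = graph_complex (Gens J) (cycle_edges boundary_cycle)"
proof
  show "graph_complex (Gens J) (cycle_edges boundary_cycle) \<subseteq> Scarf J"
  proof -
    have "cycle_edges boundary_cycle \<subseteq> Scarf J"
      unfolding cycle_edges_boundary_cycle using edge_in_Scarf by blast
    then show ?thesis
      using Scarf_vertices[OF finite_Gens zero_notin_Gens antichain_Gens] by (auto simp: graph_complex_def)
  qed
  show "Scarf J \<subseteq> graph_complex (Gens J) (cycle_edges boundary_cycle)"
  proof
    fix \<sigma> assume S: "\<sigma> \<in> Scarf J"
    then have sub: "\<sigma> \<subseteq> Gens J" by (auto simp: Scarf_def Taylor_def)
    consider "\<sigma> = {}" | p where "\<sigma> = {p}" | p q where "p \<in> \<sigma>" "q \<in> \<sigma>" "p \<noteq> q" by blast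
    then show "\<sigma> \<in> graph_complex (Gens J) (cycle_edges boundary_cycle)"
    proof cases
      case 3
      then have "p \<in> Gens J" "q \<in> Gens J" using sub by auto
      then obtain i j k i' j' k' where pq: "p = pt i j k" "q = pt i' j' k'" "i + j + k = t" "i' + j' + k' = t"
        unfolding Gens_J by blast
      have nb: "cyclic_neighbours (i, j, k) (i', j', k')"
        using 3 pq by (intro Scarf_pair[OF S]) auto
      have "u = p \<or> u = q" if "u \<in> \<sigma>" for u
      proof (rule ccontr)
        assume ne: "\<not> ?thesis"
        have "u \<in> Gens J" using sub that by auto
        then obtain l m n where u: "u = pt l m n" "l + m + n = t" unfolding Gens_J by blast
        have "cyclic_neighbours (i, j, k) (l, m, n)" "cyclic_neighbours (i', j', k') (l, m, n)"
          using 3 pq that u ne by (auto intro!: Scarf_pair[OF S])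
        then show False using no_three_neighbours[OF pq(3,4) u(2) nb] by blast
      qed
      then have "\<sigma> = {pt i j k, pt i' j' k'}" using 3 pq by blast
      then have "\<sigma> \<in> cycle_edges boundary_cycle"
        using pq nb unfolding cycle_edges_boundary_cycle by blast
      then show ?thesis by (simp add: graph_complex_def)
    qed (use sub in \<open>auto simp: graph_complex_def\<close>)
  qed
qed

lemma no_Scarf_resolution: "\<not> has_Scarf_resolution J"
proof -
  \<comment> \<open>the two neighbours of the corner \<open>(t, 0, 0)\<close>: a cycle neighbour of \<open>u\<close> either is that corner or
    moves away from it along the side of \<open>u\<close>, and in both cases leaves the box below \<open>(t - 1, 1, 1)\<close>\<close>
  let ?u = "pt (t - 1) 1 0" and ?w = "pt (t - 1) 0 1"
  have "\<not> v \<preceq> label {?u, ?w}" if v: "{?u, v} \<in> Scarf J" "v \<noteq> ?u" for v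
  proof
    assume le: "v \<preceq> label {?u, ?w}"
    have "v \<in> Gens J" using v by (auto simp: Scarf_def Taylor_def)
    then obtain l m n where vn: "v = pt l m n" "l + m + n = t" by (auto simp: Gens_J)
    have "cyclic_neighbours (t - 1, 1, 0) (l, m, n)"
      using v vn t_ge_2 by (intro Scarf_pair[OF v(1)]) auto
    moreover have "l \<le> t - 1" "m \<le> 1" "n \<le> 1"
      using le by (auto simp: vn mdvd_def all_vars)
    ultimately show False using vn t_ge_2 by (auto simp: cyclic_neighbours_def)
  qed
  moreover have "?u \<in> Gens J" "?w \<in> Gens J" using t_ge_2 by (auto intro!: pt_in_Gens)
  then have "{?u} \<in> Scarf J" "{?w} \<in> Scarf J"
    unfolding Scarf_eq graph_complex_def by blast+
  moreover have "?u \<noteq> ?w" by simp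
  ultimately show ?thesis
    unfolding has_Scarf_resolution_def
    using not_resolution_if_isolated_syzygy[of ?u "Scarf J" ?w] by blast
qed

end

lemma products_claw:
  fixes a b c d :: "'v::finite"
  assumes "claw E a b c d"
  shows "products {Poly_Mapping.single x 1 + Poly_Mapping.single y 1 | x y. {x, y} \<in> E} t
    = {mono4 a b c d t i j k | i j k. i + j + k = t}" (is "products ?A t = ?P t")
proof -
  interpret four_variables a b c d
    using assms by unfold_locales (auto simp: claw_def)
  let ?S = "{mono4 a b c d 1 1 0 0, mono4 a b c d 1 0 1 0, mono4 a b c d 1 0 0 1}"
  have A: "?A = ?S"
    using assms by (auto simp: claw_def mono4_def doubleton_eq_iff ac_simps)
  show ?thesis
    unfolding A
  proof (rule products_eqI)
    show "?P 0 = {0}" by (auto simp: mono4_def)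
  next
    fix t u v assume uv: "u \<in> ?P t" "v \<in> ?S"
    from uv show "u + v \<in> ?P (Suc t)" by auto
  next
    fix t x assume "x \<in> ?P (Suc t)"
    then obtain i j k where x: "x = mono4 a b c d (Suc t) i j k" "i + j + k = Suc t" by auto
    \<comment> \<open>split off an edge belonging to the first positive coordinate\<close>
    let ?i = "if i > 0 then 1 else 0 :: nat" and ?j = "if i = 0 \<and> j > 0 then 1 else 0 :: nat"
      and ?k = "if i = 0 \<and> j = 0 then 1 else 0 :: nat"
    have "x = mono4 a b c d t (i - ?i) (j - ?j) (k - ?k) + mono4 a b c d 1 ?i ?j ?k"
      using x by auto
    moreover have "(i - ?i) + (j - ?j) + (k - ?k) = t" using x by auto
    moreover have "mono4 a b c d 1 ?i ?j ?k \<in> ?S"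
      using x by auto
    ultimately show "\<exists>u\<in>?P t. \<exists>v\<in>?S. x = u + v"
      by blast
  qed
qed

lemma claw_power_edge_ideal:
  assumes "claw E a b c d" "t \<ge> 2"
  shows "claw_power a b c d t (ideal_power (edge_ideal E :: ('v::finite, 'k::field) mpoly set) t)"
proof -
  interpret four_variables a b c d
    using assms(1) by unfold_locales (auto simp: claw_def)
  show ?thesis
  proof unfold_locales
    show "Gens (ideal_power (edge_ideal E :: ('v, 'k) mpoly set) t)
      = {mono4 a b c d t i j k | i j k. i + j + k = t}"
      by (subst Gens_edge_ideal_power; unfold products_claw[OF assms(1)]) auto
  qed (use assms(2) in auto)
qed

section \<open>Scarf complexes of powers of the four edge ideals\<close>

theorem theorem8p2:
  fixes E :: "'v::finite set set" and I :: "('v, 'k::field) mpoly set" and t :: nat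
  assumes "simple_graph E" and "I = edge_ideal E" and "t \<ge> 1"
  shows
   "((\<exists>a b c. triangle E a b c) \<longrightarrow>
       (\<exists>V. card V = (t + 2 choose 2) \<and> Scarf (ideal_power I t) = graph_complex V {}))
    \<and>
    (\<forall>a b c d. t \<ge> 2 \<and> path3 E a b c d \<longrightarrow>
       (let D = {(i, k). i + k \<le> t};
            m = (\<lambda>i k. mono4 a b c d i (t - k) (t - i) k)
        in inj_on (\<lambda>(i, k). m i k) D \<and>
           Scarf (ideal_power I t) = graph_complex {m i k | i k. (i, k) \<in> D} (grid_edges D m)))
    \<and>
    (\<forall>a b c d. t \<ge> 2 \<and> claw E a b c d \<longrightarrow>
       (let m = mono4 a b c d t;
            L = map (\<lambda>i. m (t - i) i 0) [0..<t] @ map (\<lambda>i. m 0 (t - i) i) [0..<t]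
                @ map (\<lambda>i. m i 0 (t - i)) [0..<t]
        in length L = 3 * t \<and> distinct L \<and>
           set L = {m i j k | i j k. i + j + k = t \<and> (i = 0 \<or> j = 0 \<or> k = 0)} \<and>
           (\<exists>W. finite W \<and> W \<inter> set L = {} \<and> int (card W) = int (t + 2 choose 2) - 3 * int t \<and>
                Scarf (ideal_power I t) = graph_complex (set L \<union> W) (cycle_edges L))))
    \<and>
    (\<forall>a b c d. square E a b c d \<longrightarrow>
       (let D = {(i, j). i \<le> t \<and> j \<le> t};
            m = (\<lambda>i j. mono4 a b c d i j (t - i) (t - j))
        in inj_on (\<lambda>(i, j). m i j) D \<and>
           Scarf (ideal_power I t) = graph_complex {m i j | i j. (i, j) \<in> D} (grid_edges D m)))
    \<and>
    ((\<exists>a b c. triangle E a b c) \<or> (\<exists>a b c d. square E a b c d) \<or>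
       t \<ge> 2 \<and> ((\<exists>a b c d. path3 E a b c d) \<or> (\<exists>a b c d. claw E a b c d))
     \<longrightarrow> \<not> has_Scarf_resolution (ideal_power I t))"
proof (intro conjI allI impI)
  let ?J = "ideal_power I t"
  note I = assms(2) and t1 = assms(3)
  show "\<exists>V. card V = (t + 2 choose 2) \<and> Scarf ?J = graph_complex V {}"
    if G: "\<exists>a b c. triangle E a b c"
  proof -
    obtain a b c where "triangle E a b c" using G by blast
    then interpret triangle_power a b c t ?J unfolding I using t1 by (rule triangle_power_edge_ideal)
    show ?thesis using card_Gens Scarf_eq by blast
  qed
  show "let D = {(i, k). i + k \<le> t};
            m = (\<lambda>i k. mono4 a b c d i (t - k) (t - i) k)
        in inj_on (\<lambda>(i, k). m i k) D \<and>
           Scarf ?J = graph_complex {m i k | i k. (i, k) \<in> D} (grid_edges D m)"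
    if G: "t \<ge> 2 \<and> path3 E a b c d" for a b c d
  proof -
    interpret grid a d c b "{(i, k). i + k \<le> t}" t ?J
      unfolding I using G t1 by (intro path3_edge_ideal_grid) auto
    have "mono4 a b c d i j k l = mono4 a d c b i l k j" for i j k l
      by (simp add: mono4_def ac_simps)
    then show ?thesis using inj_pt Scarf_eq unfolding Let_def by (simp only: simp_thms)
  qed
  show "let m = mono4 a b c d t;
            L = map (\<lambda>i. m (t - i) i 0) [0..<t] @ map (\<lambda>i. m 0 (t - i) i) [0..<t]
                @ map (\<lambda>i. m i 0 (t - i)) [0..<t]
        in length L = 3 * t \<and> distinct L \<and>
           set L = {m i j k | i j k. i + j + k = t \<and> (i = 0 \<or> j = 0 \<or> k = 0)} \<and>
           (\<exists>W. finite W \<and> W \<inter> set L = {} \<and> int (card W) = int (t + 2 choose 2) - 3 * int t \<and>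
                Scarf ?J = graph_complex (set L \<union> W) (cycle_edges L))"
    if G: "t \<ge> 2 \<and> claw E a b c d" for a b c d
  proof -
    interpret claw_power a b c d t ?J
      unfolding I using G by (intro claw_power_edge_ideal) auto
    let ?W = "Gens ?J - set boundary_cycle"
    have sub: "set boundary_cycle \<subseteq> Gens ?J"
      unfolding set_boundary_cycle Gens_J by blast
    have "card (set boundary_cycle) = 3 * t"
      using distinct_boundary_cycle length_boundary_cycle distinct_card by metis
    then have "int (card ?W) = int (t + 2 choose 2) - 3 * int t"
      using card_Diff_subset[of "set boundary_cycle" "Gens ?J"] card_mono[OF finite_Gens sub] sub
      by (simp add: card_Gens of_nat_diff)
    moreover have "set boundary_cycle \<union> ?W = Gens ?J" using sub by blast
    ultimately have "\<exists>W. finite W \<and> W \<inter> set boundary_cycle = {} \<and> int (card W) = int (t + 2 choose 2) - 3 * int t \<and>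
                Scarf ?J = graph_complex (set boundary_cycle \<union> W) (cycle_edges boundary_cycle)"
      using finite_Gens Scarf_eq by (intro exI[of _ ?W]) auto
    then show ?thesis
      using length_boundary_cycle distinct_boundary_cycle set_boundary_cycle
      unfolding Let_def boundary_cycle_def by blast
  qed
  show "let D = {(i, j). i \<le> t \<and> j \<le> t};
            m = (\<lambda>i j. mono4 a b c d i j (t - i) (t - j))
        in inj_on (\<lambda>(i, j). m i j) D \<and>
           Scarf ?J = graph_complex {m i j | i j. (i, j) \<in> D} (grid_edges D m)"
    if G: "square E a b c d" for a b c d
  proof -
    interpret grid a b c d "{(i, j). i \<le> t \<and> j \<le> t}" t ?J
      unfolding I using G t1 by (rule square_edge_ideal_grid)
    show ?thesis using inj_pt Scarf_eq unfolding Let_def by blast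
  qed
  show "\<not> has_Scarf_resolution ?J"
    if G: "(\<exists>a b c. triangle E a b c) \<or> (\<exists>a b c d. square E a b c d) \<or>
       t \<ge> 2 \<and> ((\<exists>a b c d. path3 E a b c d) \<or> (\<exists>a b c d. claw E a b c d))"
  proof -
    consider (triangle) a b c where "triangle E a b c"
      | (square) a b c d where "square E a b c d"
      | (path3) a b c d where "t \<ge> 2" "path3 E a b c d"
      | (claw) a b c d where "t \<ge> 2" "claw E a b c d"
      using G by blast
    then show ?thesis
    proof cases
      case triangle
      then interpret triangle_power a b c t ?J unfolding I using t1 by (rule triangle_power_edge_ideal)
      show ?thesis by (rule no_Scarf_resolution)
    next
      case square
      then interpret grid a b c d "{(i, j). i \<le> t \<and> j \<le> t}" t ?J
        unfolding I using t1 by (rule square_edge_ideal_grid)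
      show ?thesis using t1 by (intro no_Scarf_resolution) auto
    next
      case path3
      then interpret grid a d c b "{(i, k). i + k \<le> t}" t ?J
        unfolding I using t1 by (intro path3_edge_ideal_grid)
      show ?thesis using path3 by (intro no_Scarf_resolution) auto
    next
      case claw
      then interpret claw_power a b c d t ?J
        unfolding I by (intro claw_power_edge_ideal)
      show ?thesis by (rule no_Scarf_resolution)
    qed
  qed
qed

end
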